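(* Let $H$ be a separable Hilbert space, $E$ a separable Banach space, and $\boldsymbol\eta=\{\eta_k\}_{k\in\mathbb Z}$ a stationary $E$-valued process such that $\mathcal K:=\operatorname{supp}\mathcal D(\eta_k)$ is a compact subset of $E$. Let $S:H\times E\to H$ be twice continuously differentiable and bounded on bounded subsets together with its derivatives up to second order, and let $X\subset H$ be a compact set such that $S(X\times\mathcal K)\subset X$. Suppose that Hypotheses (SF), (GD), (ALC), (DLP$'$) and (SRZ) stated in the context are fulfilled, and let $\mu\in\mathcal P(X)$ be the limiting measure of the system $u_k=S(u_{k-1},\eta_k)$ (see context). Then the equation $u_k=S(u_{k-1},\eta_k)$, $k\ge1$, possesses a weak solution $\{(\hat u_k,\hat{\boldsymbol\xi}_k),k\in\mathbb Z_+\}$ that is a stationary process in $X\times\mathcal E$. That is, on some probability space there are a process $\{\hat\eta_k\}_{k\in\mathbb Z}$ distributed as $\boldsymbol\eta$ and $X$-valued random variables $\hat u_k$, $k\ge0$, with $\hat u_k=S(\hat u_{k-1},\hat\eta_k)$ for $k\ge1$, such that, with $\hat{\boldsymbol\xi}_k=(\hat\eta_l,l\le k)$, the process $\{(\hat u_k,\hat{\boldsymbol\xi}_k),k\in\mathbb Z_+\}$ is stationary. Moreover, $\mathcal D(\hat u_k)=\mu$ for all $k\ge0$.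
   Context: Notation. $\mathcal P(Y)$: Borel probability measures on $Y$; $\mathcal D(\cdot)$: law; $\|\mu-\nu\|_{\mathrm{var}}=\sup_\Gamma|\mu(\Gamma)-\nu(\Gamma)|$; $\|\mu-\nu\|_L^*=\sup|\langle f,\mu\rangle-\langle f,\nu\rangle|$ over Lipschitz $f$ with $|f|\le1$, $\operatorname{Lip}(f)\le1$. $\mathbb Z_-=\{0,-1,-2,\dots\}$; $\boldsymbol{\mathcal K}=\mathcal K^{\mathbb Z_-}$ carries the distance $\mathrm d(\boldsymbol\xi,\boldsymbol\xi')=\sum_{k\le0}\iota^k\|\xi_k-\xi'_k\|_E$ with a fixed $\iota>1$. $\sigma\in\mathcal P(\boldsymbol{\mathcal K})$ is the law of $\{\eta_k,k\in\mathbb Z_-\}$ and $\mathcal E:=\operatorname{supp}\sigma$. $Q(\boldsymbol\xi;\cdot)$ is the conditional law of $\eta_1$ given $\{\eta_k\}_{k\in\mathbb Z_-}=\boldsymbol\xi$. For integers $k\ge1$, $$\boldsymbol Q_k(\boldsymbol\xi;dy_1,\dots,dy_k)=Q(\boldsymbol\xi;dy_1)Q(\boldsymbol\xi_1;dy_2)\cdots Q(\boldsymbol\xi_{k-1};dy_k),$$ where $\boldsymbol\xi_l=(\boldsymbol\xi,y_1,\dots,y_l)$ is the concatenation; for $k\ge0,m\ge1$, $Q_k^m(\boldsymbol\xi;\cdot)$ is the projection of $\boldsymbol Q_{k+m}(\boldsymbol\xi;\cdot)$ to the last $m$ components. $\mathbf 0_n=(0,\dots,0)\in E^n$ and $\mathcal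 O_\delta(\mathbf 0_n)$ is the product of $n$ open $\delta$-balls of $E$ centred at $0$. $S_k(u;\mathbf 0_k)$ is the value $u_k$ of the trajectory $u_j=S(u_{j-1},0)$, $u_0=u$. (SF) $Q(\boldsymbol\xi;\cdot)$ can be chosen to be a continuous map from $\mathcal E$ to $\mathcal P(\mathcal K)\subset\mathcal P(E)$ (weak topology), and there is $C>0$ with $\|Q(\boldsymbol\xi;\cdot)-Q(\boldsymbol\xi';\cdot)\|_{\mathrm{var}}\le C\,\mathrm d(\boldsymbol\xi,\boldsymbol\xi')$ for $\boldsymbol\xi,\boldsymbol\xi'\in\mathcal E$. (GD) There are an integer $k\ge1$ and $a\in(0,1)$ such that $\|S_k(u;\mathbf 0_k)\|_H\le a\|u\|_H$ for any $u\in H$. (ALC) There are an open set $O\supset X\times\mathcal K$ in $H\times E$ and a finite-dimensional determining subspace $G\subset H$ such that the closure of the image of $D_\eta S(u,\eta):E\to H$ contains $G$ for any $(u,\eta)\in O$. Here a closed subspace $G\subset H$ is determining if there is $\varkappa\in(0,1)$ such that $\|(I-\mathsf P_G)D_uS(u,\eta)\|_{\mathcal L(H)}\le\varkappa$ for any $u\in X$, $\eta\in\mathcal K$, where $\mathsf P_G$ is the orthogonal projection to $G$. (DLP$'$) There is an increasing sequence of finite-dimensional subspaces $F_n\subset E$ with complementary subspaces $F_n^\dagger\subset E$ and projections $\mathsf P_n:E\to F_n$ (along $F_n^\dagger$) such that $\cup_nF_n$ is dense in $E$, the norms of $\mathsf P_n$ are bounded uniformly in $n$, and for each $n\ge1$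 and $\boldsymbol\xi\in\mathcal E$, $Q(\boldsymbol\xi;dy)=Q_n^\dagger(\boldsymbol\xi;dy_n^\dagger)\,\rho_n(\boldsymbol\xi,y_n^\dagger,y_n)\,\ell_n(dy_n)$, where $y=(y_n,y_n^\dagger)$ corresponds to $E=F_n\dotplus F_n^\dagger$, $Q_n^\dagger(\boldsymbol\xi;\cdot)$ is the image of $Q(\boldsymbol\xi;\cdot)$ under $I-\mathsf P_n$, $\ell_n$ is Lebesgue measure on $F_n$, and $\rho_n:\mathcal E\times E\to\mathbb R_+$ is Lipschitz continuous. (SRZ) For any $n\in\mathbb N$ and $\delta>0$ there is an integer $s\ge0$ such that $\inf_{\boldsymbol\xi\in\mathcal E}Q_s^n(\boldsymbol\xi;\mathcal O_\delta(\mathbf 0_n))>0$. Limiting measure. Under these hypotheses there is a unique $\mu\in\mathcal P(X)$ for which there are $C,\gamma>0$ such that for any $u\in X$ the trajectory with $u_0=u$ satisfies $\|\mathcal D(u_k)-\mu\|_L^*\le Ce^{-\gamma k}$, $k\ge0$. *)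

theory Defs
  imports "HOL-Probability.Probability"
begin

definition msupport :: "'a::topological_space measure \<Rightarrow> 'a set"
  where "msupport \<mu> = {x. \<forall>U. open U \<and> x \<in> U \<longrightarrow> emeasure \<mu> U > 0}"

definition var_dist :: "'a measure \<Rightarrow> 'a measure \<Rightarrow> real"
  where "var_dist \<mu> \<nu> = (SUP \<Gamma>\<in>sets \<mu>. \<bar>measure \<mu> \<Gamma> - measure \<nu> \<Gamma>\<bar>)"

text \<open>Probability measures on a Borel subset \<open>Y\<close> of a type are represented by Borel measures on
  the type that give \<open>Y\<close> full mass.\<close>

definition prob_on :: "'a::topological_space set \<Rightarrow> 'a measure \<Rightarrow> bool"
  where "prob_on Y \<mu> \<longleftrightarrow> prob_space \<mu> \<and> sets \<mu> = sets borel \<and> emeasure \<mu> Y = 1"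

definition dual_lip_dist :: "'a::metric_space set \<Rightarrow> 'a measure \<Rightarrow> 'a measure \<Rightarrow> real"
  where "dual_lip_dist Y \<mu> \<nu> =
    (SUP f\<in>{f :: 'a \<Rightarrow> real. 1-lipschitz_on Y f \<and> (\<forall>x\<in>Y. \<bar>f x\<bar> \<le> 1)}.
       \<bar>(LINT x:Y|\<mu>. f x) - (LINT x:Y|\<nu>. f x)\<bar>)"

definition stationary_process ::
  "'w measure \<Rightarrow> ('t::monoid_add \<Rightarrow> 'w \<Rightarrow> 'a::topological_space) \<Rightarrow> bool"
  where "stationary_process M Z \<longleftrightarrow>
    (\<forall>t. Z t \<in> borel_measurable M) \<and>
    (\<forall>s. distr M (\<Pi>\<^sub>M t\<in>UNIV. borel) (\<lambda>\<omega> t. Z (t + s) \<omega>)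
        = distr M (\<Pi>\<^sub>M t\<in>UNIV. borel) (\<lambda>\<omega> t. Z t \<omega>))"

text \<open>The kernel is taken on the whole space of values of \<open>V\<close>. A continuous version given on the
  closed support of the law of \<open>V\<close> extends measurably, e.g. by a constant, and the extension does
  not affect the hypotheses below.\<close>

definition cond_law ::
  "'w measure \<Rightarrow> ('w \<Rightarrow> 'a::topological_space) \<Rightarrow> ('w \<Rightarrow> 'b::topological_space) \<Rightarrow>
    ('a \<Rightarrow> 'b measure) \<Rightarrow> bool"
  where "cond_law M V W Q \<longleftrightarrow>
    Q \<in> borel \<rightarrow>\<^sub>M prob_algebra borel \<and>
    (\<forall>A\<in>sets borel. \<forall>B\<in>sets borel.
       emeasure M {\<omega>\<in>space M. V \<omega> \<in> A \<and> W \<omega> \<in> B}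
         = (\<integral>\<^sup>+ v. emeasure (Q v) B * indicator A v \<partial>distr M borel V))"

text \<open>A sequence \<open>(\<xi>\<^sub>k)\<close>, \<open>k \<le> 0\<close>, is represented by a function on \<open>nat\<close> whose value at \<open>i\<close> is
  the component with index \<open>k = -i\<close>. For sequences with values in a bounded set the metric below
  induces the product topology, which is the topology of the function type.\<close>

definition seq_dist :: "real \<Rightarrow> (nat \<Rightarrow> 'e::real_normed_vector) \<Rightarrow> (nat \<Rightarrow> 'e) \<Rightarrow> real"
  where "seq_dist \<iota> \<xi> \<xi>' = (\<Sum>i. \<iota> powi (- int i) * norm (\<xi> i - \<xi>' i))"

definition past :: "(int \<Rightarrow> 'w \<Rightarrow> 'e) \<Rightarrow> int \<Rightarrow> 'w \<Rightarrow> nat \<Rightarrow> 'e"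
  where "past \<eta> k \<omega> = (\<lambda>i. \<eta> (k - int i) \<omega>)"

text \<open>The concatenation \<open>(\<xi>, y\<^sub>1, \<dots>, y\<^sub>k)\<close>; the index \<open>0\<close> carries the last entry \<open>y\<^sub>k\<close>.\<close>

definition seq_append :: "(nat \<Rightarrow> 'e) \<Rightarrow> nat \<Rightarrow> (nat \<Rightarrow> 'e) \<Rightarrow> nat \<Rightarrow> 'e"
  where "seq_append \<xi> k y = (\<lambda>i. if i < k then y (k - i) else \<xi> (i - k))"

text \<open>The measure \<open>Q(\<xi>; dy\<^sub>1) Q(\<xi>\<^sub>1; dy\<^sub>2) \<dots> Q(\<xi>\<^bsub>k-1\<^esub>; dy\<^sub>k)\<close> on \<open>E\<^sup>k\<close>, elements of which are
  represented by extensional functions on \<open>{1..k}\<close>.\<close>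

primrec path_kernel ::
  "((nat \<Rightarrow> 'e) \<Rightarrow> 'e::topological_space measure) \<Rightarrow> nat \<Rightarrow> (nat \<Rightarrow> 'e) \<Rightarrow> (nat \<Rightarrow> 'e) measure"
  where
    "path_kernel Q 0 \<xi> = return (\<Pi>\<^sub>M j\<in>{1..0}. borel) (\<lambda>_. undefined)"
  | "path_kernel Q (Suc k) \<xi> =
      path_kernel Q k \<xi> \<bind>
        (\<lambda>y. distr (Q (seq_append \<xi> k y)) (\<Pi>\<^sub>M j\<in>{1..Suc k}. borel) (\<lambda>z. y(Suc k := z)))"

text \<open>\<open>proj_kernel Q k m \<xi>\<close> is \<open>Q\<^sub>k\<^sup>m(\<xi>; \<cdot>)\<close>, the image under the projection to the last \<open>m\<close> of
  \<open>k + m\<close> components.\<close>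

definition proj_kernel ::
  "((nat \<Rightarrow> 'e) \<Rightarrow> 'e::topological_space measure) \<Rightarrow> nat \<Rightarrow> nat \<Rightarrow> (nat \<Rightarrow> 'e) \<Rightarrow> (nat \<Rightarrow> 'e) measure"
  where "proj_kernel Q k m \<xi> =
    distr (path_kernel Q (k + m) \<xi>) (\<Pi>\<^sub>M j\<in>{1..m}. borel) (\<lambda>y. \<lambda>j\<in>{1..m}. y (k + j))"

primrec traj :: "('h \<times> 'e \<Rightarrow> 'h) \<Rightarrow> 'h \<Rightarrow> (nat \<Rightarrow> 'e) \<Rightarrow> nat \<Rightarrow> 'h"
  where
    "traj S u y 0 = u"
  | "traj S u y (Suc k) = S (traj S u y k, y (Suc k))"

definition C2_bdd_on_bounded :: "('a::real_normed_vector \<Rightarrow> 'b::real_normed_vector) \<Rightarrow> bool"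
  where "C2_bdd_on_bounded f \<longleftrightarrow>
    (\<exists>(f' :: 'a \<Rightarrow> 'a \<Rightarrow>\<^sub>L 'b) (f'' :: 'a \<Rightarrow> 'a \<Rightarrow>\<^sub>L ('a \<Rightarrow>\<^sub>L 'b)).
       (\<forall>x. (f has_derivative blinfun_apply (f' x)) (at x)) \<and>
       (\<forall>x. (f' has_derivative blinfun_apply (f'' x)) (at x)) \<and>
       continuous_on UNIV f'' \<and>
       (\<forall>B. bounded B \<longrightarrow> bounded (f ` B) \<and> bounded (f' ` B) \<and> bounded (f'' ` B)))"

definition limiting_measure ::
  "'w measure \<Rightarrow> (int \<Rightarrow> 'w \<Rightarrow> 'e) \<Rightarrow> ('h::metric_space \<times> 'e \<Rightarrow> 'h) \<Rightarrow> 'h set \<Rightarrow> 'h measure \<Rightarrow> bool"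
  where "limiting_measure M \<eta> S X \<mu> \<longleftrightarrow>
    prob_on X \<mu> \<and>
    (\<exists>C>0. \<exists>\<gamma>>0. \<forall>u\<in>X. \<forall>k.
       dual_lip_dist X (distr M borel (\<lambda>\<omega>. traj S u (\<lambda>j. \<eta> (int j) \<omega>) k)) \<mu>
         \<le> C * exp (- \<gamma> * real k))"

definition hyp_SF ::
  "real \<Rightarrow> 'e::real_normed_vector set \<Rightarrow> (nat \<Rightarrow> 'e) set \<Rightarrow> ((nat \<Rightarrow> 'e) \<Rightarrow> 'e measure) \<Rightarrow> bool"
  where "hyp_SF \<iota> K \<E> Q \<longleftrightarrow>
    (\<forall>\<xi>\<in>\<E>. prob_on K (Q \<xi>)) \<and>
    (\<forall>f :: 'e \<Rightarrow> real. continuous_on UNIV f \<and> bounded (range f) \<longrightarrow>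
       continuous_on \<E> (\<lambda>\<xi>. \<integral>y. f y \<partial>Q \<xi>)) \<and>
    (\<exists>C>0. \<forall>\<xi>\<in>\<E>. \<forall>\<xi>'\<in>\<E>. var_dist (Q \<xi>) (Q \<xi>') \<le> C * seq_dist \<iota> \<xi> \<xi>')"

definition hyp_GD :: "('h::real_normed_vector \<times> 'e::zero \<Rightarrow> 'h) \<Rightarrow> bool"
  where "hyp_GD S \<longleftrightarrow>
    (\<exists>k\<ge>1. \<exists>a. 0 < a \<and> a < 1 \<and> (\<forall>u. norm (traj S u (\<lambda>_. 0) k) \<le> a * norm u))"

definition orth_proj :: "'h::real_inner set \<Rightarrow> 'h \<Rightarrow> 'h"
  where "orth_proj G x = (THE p. p \<in> G \<and> (\<forall>g\<in>G. (x - p) \<bullet> g = 0))"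

definition determining ::
  "('h::real_inner \<times> 'e \<Rightarrow> 'h) \<Rightarrow> 'h set \<Rightarrow> 'e set \<Rightarrow> 'h set \<Rightarrow> bool"
  where "determining S X K G \<longleftrightarrow>
    subspace G \<and> closed G \<and>
    (\<exists>\<kappa>. 0 < \<kappa> \<and> \<kappa> < 1 \<and> (\<forall>u\<in>X. \<forall>y\<in>K.
       onorm (\<lambda>v. let w = frechet_derivative (\<lambda>u'. S (u', y)) (at u) v in w - orth_proj G w)
         \<le> \<kappa>))"

definition hyp_ALC ::
  "('h::real_inner \<times> 'e::real_normed_vector \<Rightarrow> 'h) \<Rightarrow> 'h set \<Rightarrow> 'e set \<Rightarrow> bool"
  where "hyp_ALC S X K \<longleftrightarrow>
    (\<exists>U G. open U \<and> X \<times> K \<subseteq> U \<and>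
       determining S X K G \<and> (\<exists>B. finite B \<and> G = span B) \<and>
       (\<forall>(u, y)\<in>U. G \<subseteq> closure (range (frechet_derivative (\<lambda>y'. S (u, y')) (at y)))))"

definition projection_along ::
  "('e::real_normed_vector \<Rightarrow> 'e) \<Rightarrow> 'e set \<Rightarrow> 'e set \<Rightarrow> bool"
  where "projection_along P F F' \<longleftrightarrow>
    subspace F \<and> subspace F' \<and> F \<inter> F' = {0} \<and>
    bounded_linear P \<and> (\<forall>x. P x \<in> F \<and> x - P x \<in> F')"

text \<open>Lebesgue measure on a finite-dimensional subspace \<open>F\<close>, transported by the coordinates of a
  basis; it is determined up to a positive factor. It is regarded as a measure on the whole space
  concentrated on \<open>F\<close>.\<close>

definition lebesgue_measure_on :: "'e::real_normed_vector set \<Rightarrow> 'e measure \<Rightarrow> bool"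
  where "lebesgue_measure_on F l \<longleftrightarrow>
    (\<exists>B. finite B \<and> independent B \<and> span B = F \<and>
       l = distr (\<Pi>\<^sub>M b\<in>B. (lborel :: real measure)) borel (\<lambda>c. \<Sum>b\<in>B. c b *\<^sub>R b))"

definition hyp_DLP' ::
  "real \<Rightarrow> (nat \<Rightarrow> 'e::real_normed_vector) set \<Rightarrow> ((nat \<Rightarrow> 'e) \<Rightarrow> 'e measure) \<Rightarrow> bool"
  where "hyp_DLP' \<iota> \<E> Q \<longleftrightarrow>
    (\<exists>(F :: nat \<Rightarrow> 'e set) (F' :: nat \<Rightarrow> 'e set) (P :: nat \<Rightarrow> 'e \<Rightarrow> 'e) (l :: nat \<Rightarrow> 'e measure)
      (\<rho> :: nat \<Rightarrow> (nat \<Rightarrow> 'e) \<Rightarrow> 'e \<Rightarrow> real).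
       (\<forall>n\<ge>1. F n \<subseteq> F (Suc n)) \<and>
       closure (\<Union>n\<in>{1..}. F n) = UNIV \<and>
       (\<exists>C. \<forall>n\<ge>1. onorm (P n) \<le> C) \<and>
       (\<forall>n\<ge>1.
          projection_along (P n) (F n) (F' n) \<and>
          lebesgue_measure_on (F n) (l n) \<and>
          (\<forall>\<xi>\<in>\<E>. \<forall>y. \<rho> n \<xi> y \<ge> 0) \<and>
          (\<exists>L. \<forall>\<xi>\<in>\<E>. \<forall>\<xi>'\<in>\<E>. \<forall>y y'.
             \<bar>\<rho> n \<xi> y - \<rho> n \<xi>' y'\<bar> \<le> L * (seq_dist \<iota> \<xi> \<xi>' + norm (y - y'))) \<and>
          (\<forall>\<xi>\<in>\<E>. \<forall>A\<in>sets borel.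
             emeasure (Q \<xi>) A =
               (\<integral>\<^sup>+ y'. (\<integral>\<^sup>+ y. indicator A (y + y') * ennreal (\<rho> n \<xi> (y + y')) \<partial>l n)
                  \<partial>distr (Q \<xi>) borel (\<lambda>y. y - P n y)))))"

definition hyp_SRZ ::
  "(nat \<Rightarrow> 'e::real_normed_vector) set \<Rightarrow> ((nat \<Rightarrow> 'e) \<Rightarrow> 'e measure) \<Rightarrow> bool"
  where "hyp_SRZ \<E> Q \<longleftrightarrow>
    (\<forall>n\<ge>1. \<forall>\<delta>>0. \<exists>s.
       (INF \<xi>\<in>\<E>. emeasure (proj_kernel Q s n \<xi>) (\<Pi>\<^sub>E j\<in>{1..n}. ball 0 \<delta>)) > 0)"

end

theory Submission
  imports Defs
begin

text \<open>The argument is that of Krylov and Bogolyubov for the skew product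
  \<open>(u, w) \<mapsto> (S (u, w\<^sub>1), shift w)\<close> on the compact set \<open>X \<times> W\<close>, where \<open>W\<close> consists of the two-sided
  sequences with values in \<open>K\<close> all of whose pasts lie in \<open>\<E>\<close>. Started from \<open>\<delta>\<^sub>u \<otimes> \<D>(\<eta>)\<close>, the Cesaro
  averages of the laws have a weak limit point \<open>\<nu>\<close>, which is invariant. Its second marginal is
  \<open>\<D>(\<eta>)\<close>, since this law is shift invariant, and its first marginal is \<open>\<mu>\<close>, since
  \<open>\<D>(u\<^sub>k) \<rightarrow> \<mu>\<close> in the dual Lipschitz distance. The orbit of the skew product under \<open>\<nu>\<close> is the required
  stationary solution.

  Weak sequential compactness is derived from Helly's theorem on the real line: base 4 digits recording
  membership in the sets of a countable basis embed the compact set measurably into the reals, and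
  the inverse of this embedding is uniformly continuous.\<close>

section \<open>Bounded Lipschitz functions as a determining class\<close>

lemma measure_eqI_lipschitz:
  fixes M N :: "'a::metric_space measure"
  assumes M: "prob_space M" "sets M = sets borel" and N: "prob_space N" "sets N = sets borel"
    and eq: "\<And>f::'a \<Rightarrow> real. 1-lipschitz_on UNIV f \<Longrightarrow> (\<And>x. \<bar>f x\<bar> \<le> 1) \<Longrightarrow> (\<integral>x. f x \<partial>M) = (\<integral>x. f x \<partial>N)"
  shows "M = N"
proof -
  interpret M: prob_space M by fact
  interpret N: prob_space N by fact
  have [simp]: "space M = UNIV" "space N = UNIV"
    using M(2) N(2) by (metis sets_eq_imp_space_eq space_borel)+
  have open_eq: "emeasure M U = emeasure N U" if U: "open U" for U
  \<comment> \<open>The distance to the empty set is 0 by convention, so the approximation used in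
    the other case would give 0 for the whole space.\<close>
  proof (cases "U = UNIV")
    case True
    then show ?thesis
      using M.emeasure_space_1 N.emeasure_space_1 by simp
  next
    case False
    \<comment> \<open>Truncating at \<open>1 / (n + 1)\<close> before scaling keeps
      \<open>g n\<close> 1-Lipschitz and bounded by 1; the factor \<open>n + 1\<close> is restored
      outside the integral.\<close>
    define g where "g n x = min (1 / real (Suc n)) (infdist x (- U))" for n x
    define f where "f n x = real (Suc n) * g n x" for n x
    have lip: "1-lipschitz_on UNIV (g n)" for n
    proof (rule lipschitz_onI)
      fix x y :: 'a
      show "dist (g n x) (g n y) \<le> 1 * dist x y"
        using infdist_triangle_abs[of x "- U" y] by (auto simp: g_def dist_real_def min_def)
    qed simp
    have g1: "\<bar>g n x\<bar> \<le> 1 / real (Suc n)" for n x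
      using infdist_nonneg[of x "- U"] by (auto simp: g_def min_def)
    have g2: "\<bar>g n x\<bar> \<le> 1" for n x
      using g1[of n x] by (rule order_trans) (simp add: field_simps)
    have f1: "\<bar>f n x\<bar> \<le> 1" for n x
      using mult_left_mono[OF g1[of n x], of "real (Suc n)"]
      by (simp add: f_def abs_mult del: of_nat_Suc)
    have meas: "f n \<in> borel_measurable borel" for n
      unfolding f_def
      by (intro borel_measurable_continuous_onI continuous_intros lipschitz_on_continuous_on[OF lip])
    have lim: "(\<lambda>n. f n x) \<longlonglongrightarrow> indicator U x" for x
    proof (cases "x \<in> U")
      case True
      then have pos: "infdist x (- U) > 0"
        using False U by (intro infdist_pos_not_in_closed) (auto simp: closed_Compl)
      have "eventually (\<lambda>n. 1 / real (Suc n) < infdist x (- U)) sequentially"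
        using LIMSEQ_inverse_real_of_nat pos
        by (auto simp: inverse_eq_divide dest!: order_tendstoD(2))
      then have "eventually (\<lambda>n. f n x = indicator U x) sequentially"
        by eventually_elim (use True in \<open>simp add: f_def g_def min_def\<close>)
      then show ?thesis
        by (rule tendsto_eventually)
    next
      case False
      then have "f n x = indicator U x" for n
        by (simp add: f_def g_def)
      then show ?thesis by simp
    qed
    have limM: "(\<lambda>n. \<integral>x. f n x \<partial>M) \<longlonglongrightarrow> (\<integral>x. indicator U x \<partial>M)"
      using meas M(2) U lim f1
      by (intro integral_dominated_convergence[where w="\<lambda>_. 1"]) (auto cong: measurable_cong_sets)
    have limN: "(\<lambda>n. \<integral>x. f n x \<partial>N) \<longlonglongrightarrow> (\<integral>x. indicator U x \<partial>N)"
      using meas N(2) U lim f1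
      by (intro integral_dominated_convergence[where w="\<lambda>_. 1"]) (auto cong: measurable_cong_sets)
    have "(\<integral>x. f n x \<partial>M) = (\<integral>x. f n x \<partial>N)" for n
      unfolding f_def using eq[OF lip g2] by simp
    with limM limN have "(\<integral>x. indicator U x \<partial>M) = (\<integral>x. indicator U x \<partial>N :: real)"
      by (auto intro: LIMSEQ_unique)
    then show ?thesis
      using U M(2) N(2) by (simp add: M.emeasure_eq_measure N.emeasure_eq_measure)
  qed
  show ?thesis
  proof (rule measure_eqI_generator_eq[where E="{U. open U}" and A="\<lambda>_. UNIV" and \<Omega>=UNIV])
    show "Int_stable {U::'a set. open U}" by (auto simp: Int_stable_def)
  qed (auto simp: open_eq M(2) N(2) borel_def)
qed

section \<open>Coding a compact set by real numbers\<close>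

text \<open>Base 4 with digits 0 and 1 leaves gaps. If \<open>m\<close> is the first index with
  different digits, its term has size \<open>(1/4)^m\<close> and the later terms together at most a
  third of this, so the sums are at least \<open>2/3 * (1/4)^m\<close> apart.\<close>

lemma base4_digits_unique:
  fixes d e :: "nat \<Rightarrow> real"
  assumes d: "\<And>i. d i \<in> {0, 1}" and e: "\<And>i. e i \<in> {0, 1}"
    and close: "\<bar>(\<Sum>i. d i * (1/4)^i) - (\<Sum>i. e i * (1/4)^i)\<bar> < 2/3 * (1/4)^N"
    and "i \<le> N"
  shows "d i = e i"
proof (rule ccontr)
  assume "d i \<noteq> e i"
  define a where "a j = (d j - e j) * (1/4)^j" for j
  define m where "m = (LEAST j. d j \<noteq> e j)"
  have m: "d m \<noteq> e m" "m \<le> i" "\<And>j. j < m \<Longrightarrow> d j = e j"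
    unfolding m_def using \<open>d i \<noteq> e i\<close> LeastI[of "\<lambda>j. d j \<noteq> e j"] Least_le[of "\<lambda>j. d j \<noteq> e j"]
      not_less_Least[of _ "\<lambda>j. d j \<noteq> e j"] by blast+
  have geo: "summable (\<lambda>j. (1/4::real)^j)"
    by (simp add: summable_geometric)
  have digits_summable: "summable (\<lambda>j. c j * (1/4)^j)" if "\<And>i. c i \<in> {0, 1}" for c :: "nat \<Rightarrow> real"
  proof (rule summable_comparison_test'[OF geo, of 0])
    show "norm (c j * (1/4)^j) \<le> (1/4)^j" for j using that[of j] by auto
  qed
  note sd = digits_summable[of d, OF d] and se = digits_summable[of e, OF e]
  have sa: "summable a"
    unfolding a_def using summable_diff[OF sd se] by (simp add: algebra_simps)
  have ab: "\<bar>a j\<bar> \<le> (1/4)^j" for j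
    using d[of j] e[of j] by (auto simp: a_def abs_mult)
  have "(\<Sum>i. d i * (1/4)^i) - (\<Sum>i. e i * (1/4)^i) = suminf a"
    unfolding a_def using suminf_diff[OF sd se] by (simp add: algebra_simps)
  also have "\<dots> = (\<Sum>j. a (j + Suc m)) + (\<Sum>j<Suc m. a j)"
    by (rule suminf_split_initial_segment[OF sa])
  also have "(\<Sum>j<Suc m. a j) = a m"
    using m(3) by (simp add: a_def)
  finally have *: "(\<Sum>i. d i * (1/4)^i) - (\<Sum>i. e i * (1/4)^i) = (\<Sum>j. a (j + Suc m)) + a m" .
  have "\<bar>\<Sum>j. a (j + Suc m)\<bar> \<le> (\<Sum>j. (1/4)^Suc m * (1/4)^j)"
  proof -
    have "norm (a (j + Suc m)) \<le> (1/4)^Suc m * (1/4)^j" for j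
      using ab[of "j + Suc m"] by (simp add: power_add mult_ac)
    from norm_suminf_le[OF this summable_mult[OF geo]] show ?thesis by simp
  qed
  also have "\<dots> = (1/4)^m / 3"
    using geo by (subst suminf_mult) (auto simp: suminf_geometric)
  finally have tail: "\<bar>\<Sum>j. a (j + Suc m)\<bar> \<le> (1/4)^m / 3" .
  have "\<bar>a m\<bar> = (1/4)^m"
    using d[of m] e[of m] m(1) by (auto simp: a_def abs_mult)
  with * tail have "\<bar>(\<Sum>i. d i * (1/4)^i) - (\<Sum>i. e i * (1/4)^i)\<bar> \<ge> 2/3 * (1/4)^m"
    by linarith
  moreover have "(1/4::real)^m \<ge> (1/4)^N"
    using m(2) \<open>i \<le> N\<close> by (intro power_decreasing) auto
  ultimately show False using close by linarith
qed

lemma compact_real_coding: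
  fixes K :: "'a::{complete_space, second_countable_topology} set"
  assumes K: "compact K"
  obtains s :: "'a \<Rightarrow> real" and C :: "real set" and p :: "real \<Rightarrow> 'a"
  where "s \<in> borel_measurable borel" "compact C" "s ` K \<subseteq> C"
    "continuous_on C p" "p ` C \<subseteq> K" "\<And>x. x \<in> K \<Longrightarrow> p (s x) = x"
proof -
  obtain \<B> :: "'a set set" where \<B>: "countable \<B>" "topological_basis \<B>"
    using ex_countable_basis by blast
  have "\<B> \<noteq> {}"
    using \<B>(2) open_UNIV unfolding topological_basis_def by (metis Union_empty UNIV_not_empty subset_empty)
  define B where "B = from_nat_into \<B>"
  have rB: "range B = \<B>"
    unfolding B_def using \<B>(1) \<open>\<B> \<noteq> {}\<close> by (rule range_from_nat_into[rotated])
  have oB: "open (B i)" for i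
    using \<B>(2) rB topological_basis_open by blast
  define s :: "'a \<Rightarrow> real" where "s x = (\<Sum>i. indicator (B i) x * (1/4)^i)" for x
  have s_meas: "s \<in> borel_measurable borel"
    unfolding s_def using oB by (intro borel_measurable_suminf) simp
  have sep: "\<exists>N. \<forall>x\<in>K. \<forall>y\<in>K. \<bar>s x - s y\<bar> < 2/3 * (1/4)^N \<longrightarrow> dist x y < \<epsilon>" if "\<epsilon> > 0" for \<epsilon>
  proof -
    \<comment> \<open>Finitely many basis sets contained in balls of radius
      \<open>\<epsilon>/2\<close> cover \<open>K\<close>. If \<open>N\<close> bounds their indices,
      two points whose codes are within \<open>2/3 * (1/4)^N\<close> agree on membership in each of
      them, hence lie in a common small set.\<close>
    define I where "I = {i. \<exists>z. B i \<subseteq> ball z (\<epsilon>/2)}"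
    have "K \<subseteq> (\<Union>i\<in>I. B i)"
    proof
      fix x assume "x \<in> K"
      obtain b where "b \<in> \<B>" "x \<in> b" "b \<subseteq> ball x (\<epsilon>/2)"
        using topological_basisE[OF \<B>(2), of "ball x (\<epsilon>/2)" x] \<open>\<epsilon> > 0\<close> by auto
      then show "x \<in> (\<Union>i\<in>I. B i)"
        using rB by (auto simp: I_def)
    qed
    then obtain F where F: "F \<subseteq> I" "finite F" "K \<subseteq> (\<Union>i\<in>F. B i)"
      using compactE_image[OF K] oB by metis
    obtain N where N: "\<And>i. i \<in> F \<Longrightarrow> i \<le> N"
      using F(2) finite_nat_set_iff_bounded_le by auto
    have "dist x y < \<epsilon>" if "x \<in> K" "y \<in> K" and close: "\<bar>s x - s y\<bar> < 2/3 * (1/4)^N" for x y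
    proof -
      obtain i where i: "i \<in> F" "x \<in> B i" using F(3) \<open>x \<in> K\<close> by auto
      have "indicator (B i) x = (indicator (B i) y :: real)"
        by (rule base4_digits_unique[of "\<lambda>i. indicator (B i) x" "\<lambda>i. indicator (B i) y" N i])
          (use close N[OF i(1)] in \<open>auto simp: s_def indicator_def\<close>)
      then have "y \<in> B i" using i by (auto simp: indicator_def split: if_splits)
      moreover obtain z where "B i \<subseteq> ball z (\<epsilon>/2)" using i F(1) by (auto simp: I_def)
      ultimately have "dist z x < \<epsilon>/2" "dist z y < \<epsilon>/2" using i(2) by auto
      then show ?thesis using dist_triangle_half_r by blast
    qed
    then show ?thesis by blast
  qed
  have inj: "inj_on s K"
  proof (rule inj_onI, rule ccontr)
    fix x y assume xy: "x \<in> K" "y \<in> K" "s x = s y" "x \<noteq> y"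
    then have "dist x y > 0" by simp
    from sep[OF this] xy(1,2) obtain N
      where "\<bar>s x - s y\<bar> < 2/3 * (1/4)^N \<longrightarrow> dist x y < dist x y"
      by blast
    with xy(3) show False by simp
  qed
  define q where "q = inv_into K s"
  have q: "q (s x) = x" if "x \<in> K" for x
    unfolding q_def using inj that by simp
  have "uniformly_continuous_on (s ` K) q"
    unfolding uniformly_continuous_on_def
  proof safe
    fix \<epsilon> :: real assume "\<epsilon> > 0"
    from sep[OF this] obtain N where N: "\<And>x y. x \<in> K \<Longrightarrow> y \<in> K \<Longrightarrow> \<bar>s x - s y\<bar> < 2/3 * (1/4)^N \<Longrightarrow> dist x y < \<epsilon>"
      by blast
    show "\<exists>d>0. \<forall>x\<in>s ` K. \<forall>x'\<in>s ` K. dist x' x < d \<longrightarrow> dist (q x') (q x) < \<epsilon>"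
      by (rule exI[of _ "2/3 * (1/4)^N"]) (auto simp: q dist_real_def intro!: N)
  qed
  \<comment> \<open>Completeness of the type yields the extension; its values remain in
    \<open>K\<close> because \<open>K\<close> is closed.\<close>
  then obtain p where p: "uniformly_continuous_on (closure (s ` K)) p" "\<And>c. c \<in> s ` K \<Longrightarrow> q c = p c"
    by (rule uniformly_continuous_on_extension_on_closure) blast
  have cont: "continuous_on (closure (s ` K)) p"
    by (rule uniformly_continuous_imp_continuous[OF p(1)])
  have "\<bar>s x\<bar> \<le> 4/3" for x
  proof -
    have "\<bar>s x\<bar> \<le> (\<Sum>i. (1/4)^i)"
      unfolding s_def
      using norm_suminf_le[of "\<lambda>i. indicator (B i) x * (1/4)^i :: real" "\<lambda>j. (1/4)^j"]
      by (auto simp: indicator_def summable_geometric)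
    then show ?thesis by (simp add: suminf_geometric)
  qed
  then have "bounded (s ` K)"
    unfolding bounded_iff real_norm_def by blast
  show ?thesis
  proof
    show "compact (closure (s ` K))" using \<open>bounded (s ` K)\<close> by (simp add: compact_closure)
    show "s ` K \<subseteq> closure (s ` K)" by (rule closure_subset)
    show "continuous_on (closure (s ` K)) p" by fact
    show "p ` closure (s ` K) \<subseteq> K"
      by (rule image_closure_subset[OF cont]) (use K p(2) q in \<open>auto simp: compact_imp_closed\<close>)
    show "p (s x) = x" if "x \<in> K" for x using p(2)[of "s x"] q that by simp
  qed fact
qed

section \<open>Weak sequential compactness over a compact set\<close>

lemma prob_on_iff_AE:
  assumes "X \<in> sets borel"
  shows "prob_on X \<mu> \<longleftrightarrow> prob_space \<mu> \<and> sets \<mu> = sets borel \<and> (AE x in \<mu>. x \<in> X)"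
proof -
  have "emeasure \<mu> X = 1 \<longleftrightarrow> (AE x in \<mu>. x \<in> X)" if "prob_space \<mu>" "sets \<mu> = sets borel"
  proof -
    interpret prob_space \<mu> by fact
    show ?thesis
      using prob_eq_1[of X] assms that(2) by (simp add: emeasure_eq_measure)
  qed
  then show ?thesis by (auto simp: prob_on_def)
qed

text \<open>A sequential Prokhorov theorem. The images of the measures under the code
  \<open>s\<close> all live on the compact set \<open>C\<close>, hence are tight and have a weak
  subsequential limit \<open>L\<close>; pushing \<open>L\<close> back along \<open>p\<close> gives
  \<open>\<nu>\<close>.\<close>

lemma prob_on_compact_imp_convergent_subseq:
  fixes K :: "'a::{complete_space, second_countable_topology} set"
  assumes K: "compact K" and \<mu>: "\<And>n. prob_on K (\<mu> n)"
  obtains r :: "nat \<Rightarrow> nat" and \<nu> where "strict_mono r" "prob_on K \<nu>"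
    "\<And>f::'a \<Rightarrow> real. continuous_on UNIV f \<Longrightarrow> bounded (range f) \<Longrightarrow>
       (\<lambda>n. \<integral>x. f x \<partial>\<mu> (r n)) \<longlonglongrightarrow> (\<integral>x. f x \<partial>\<nu>)"
proof -
  obtain s C and p :: "real \<Rightarrow> 'a" where s[measurable]: "s \<in> borel_measurable borel"
    and C: "compact C" "s ` K \<subseteq> C" and p: "continuous_on C p" "p ` C \<subseteq> K" "\<And>x. x \<in> K \<Longrightarrow> p (s x) = x"
    by (rule compact_real_coding[OF K]) blast
  have K_borel[measurable]: "K \<in> sets borel" and C_borel[measurable]: "C \<in> sets borel"
    using K C by (auto intro!: borel_closed compact_imp_closed)
  note pK = prob_on_iff_AE[OF K_borel] and pC = prob_on_iff_AE[OF C_borel]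
  have [measurable_cong]: "sets (\<mu> n) = sets borel" and [simp]: "prob_space (\<mu> n)" for n
    using \<mu>[of n] by (auto simp: prob_on_def)
  have AE_K: "AE x in \<mu> n. x \<in> K" for n
    using \<mu>[of n] by (auto simp: pK)
  have "K \<noteq> {}" using \<mu>[of 0] by (auto simp: prob_on_def)
  then have "C \<noteq> {}" using C by auto
  define \<theta> where "\<theta> n = distr (\<mu> n) borel s" for n
  have rd: "real_distribution (\<theta> n)" for n
    unfolding \<theta>_def real_distribution_def real_distribution_axioms_def
    by (auto intro!: prob_space.prob_space_distr)
  have AE_C: "AE c in \<theta> n. c \<in> C" for n
    unfolding \<theta>_def by (subst AE_distr_iff) (use AE_K[of n] C in auto)
  have "tight \<theta>"
    unfolding tight_def
  proof (intro conjI allI impI rd)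
    fix \<epsilon> :: real assume "\<epsilon> > 0"
    obtain b where b: "\<And>c. c \<in> C \<Longrightarrow> \<bar>c\<bar> \<le> b"
      using compact_imp_bounded[OF C(1)] by (auto simp: bounded_iff)
    have "b \<ge> 0" using b \<open>C \<noteq> {}\<close> by force
    \<comment> \<open>\<open>tight\<close> is formulated with half-open intervals, so the left end
      is moved below \<open>- b\<close>; this also makes the interval nonempty when
      \<open>b = 0\<close>.\<close>
    have "measure (\<theta> n) {- b - 1 <.. b} = 1" for n
    proof -
      interpret real_distribution "\<theta> n" by (rule rd)
      have "AE c in \<theta> n. c \<in> {- b - 1 <.. b}"
        using AE_C[of n] by eventually_elim (use b in \<open>force simp: abs_le_iff\<close>)
      then show ?thesis by (subst prob_eq_1) auto
    qed
    then show "\<exists>a b. a < b \<and> (\<forall>n. measure (\<theta> n) {a<..b} > 1 - \<epsilon>)"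
      using \<open>b \<ge> 0\<close> \<open>\<epsilon> > 0\<close> by (intro exI[of _ "- b - 1"] exI[of _ b]) auto
  qed
  then obtain r L where r: "strict_mono r" and L: "real_distribution L"
    and conv: "weak_conv_m (\<theta> \<circ> id \<circ> r) L"
    using tight_imp_convergent_subsubsequence[OF _ strict_mono_id] by blast
  interpret L: real_distribution L by (rule L)
  have int_conv: "(\<lambda>n. \<integral>c. g c \<partial>\<theta> (r n)) \<longlonglongrightarrow> (\<integral>c. g c \<partial>L)"
    if "continuous_on UNIV g" "\<And>c. \<bar>g c\<bar> \<le> B" for g :: "real \<Rightarrow> real" and B
    using weak_conv_imp_integral_bdd_continuous_conv[of "\<theta> \<circ> id \<circ> r" L g B] rd L conv that
    by (auto simp: continuous_on_eq_continuous_at)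
  have L_C: "AE c in L. c \<in> C"
  proof -
    \<comment> \<open>A bounded continuous function whose zero set is the closed set
      \<open>C\<close>: its integrals vanish along the sequence, hence also in the limit.\<close>
    define g where "g c = min 1 (infdist c C)" for c
    have cg: "continuous_on UNIV g" unfolding g_def by (intro continuous_intros)
    have gb: "\<bar>g c\<bar> \<le> 1" and g0: "0 \<le> g c" for c
      using infdist_nonneg[of c C] by (auto simp: g_def)
    have [measurable]: "g \<in> borel_measurable borel" using cg by (rule borel_measurable_continuous_onI)
    have "(\<integral>c. g c \<partial>\<theta> n) = 0" for n
      by (rule integral_eq_zero_AE) (use AE_C[of n] in \<open>auto simp: g_def\<close>)
    with int_conv[OF cg gb] have "(\<integral>c. g c \<partial>L) = 0"
      by (simp add: LIMSEQ_const_iff)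
    moreover have "integrable L g"
      by (rule L.integrable_const_bound[of _ 1]) (use gb in auto)
    ultimately have "AE c in L. g c = 0"
      using integral_nonneg_eq_0_iff_AE[of L g] g0 by auto
    then show ?thesis
    proof eventually_elim
      case (elim c)
      then have "infdist c C = 0" by (auto simp: g_def min_def split: if_splits)
      then show ?case
        using in_closed_iff_infdist_zero[OF compact_imp_closed[OF C(1)] \<open>C \<noteq> {}\<close>] by simp
    qed
  qed
  obtain x0 where "x0 \<in> K" using \<open>K \<noteq> {}\<close> by auto
  \<comment> \<open>The default \<open>x0\<close> makes the map total with values in
    \<open>K\<close>; it is taken only outside \<open>C\<close>, on an \<open>L\<close>-null
    set.\<close>
  define p' where "p' c = (if c \<in> C then p c else x0)" for c
  have [measurable]: "p' \<in> borel_measurable borel"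
    unfolding p'_def by (rule borel_measurable_continuous_on_if[OF C_borel p(1)]) simp
  define \<nu> where "\<nu> = distr L borel p'"
  have p'K: "p' c \<in> K" for c using p \<open>x0 \<in> K\<close> by (auto simp: p'_def)
  show ?thesis
  proof
    show "strict_mono r" by fact
    show "prob_on K \<nu>"
      unfolding pK unfolding \<nu>_def
      by (auto simp: AE_distr_iff p'K intro!: L.prob_space_distr)
    fix f :: "'a \<Rightarrow> real" assume f: "continuous_on UNIV f" "bounded (range f)"
    then obtain B where B: "\<And>x. \<bar>f x\<bar> \<le> B" by (auto simp: bounded_iff)
    have [measurable]: "f \<in> borel_measurable borel" using f(1) by (rule borel_measurable_continuous_onI)
    \<comment> \<open>Weak convergence on the line needs test functions on all of it, so
      \<open>f \<circ> p\<close> is extended from \<open>C\<close> by Tietze's theorem with the same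
      bound.\<close>
    have "continuous_on C (\<lambda>c. f (p c))"
      using continuous_on_compose2[OF f(1) p(1)] by simp
    then obtain g where g: "continuous_on UNIV g" "\<And>c. c \<in> C \<Longrightarrow> g c = f (p c)" "\<And>c. \<bar>g c\<bar> \<le> B"
      using Tietze[of C "\<lambda>c. f (p c)" UNIV B] B C order_trans[OF abs_ge_zero B]
      by (auto simp: compact_imp_closed)
    have [measurable]: "g \<in> borel_measurable borel" using g(1) by (rule borel_measurable_continuous_onI)
    have "(\<integral>c. g c \<partial>\<theta> n) = (\<integral>x. f x \<partial>\<mu> n)" for n
      unfolding \<theta>_def
    proof (subst integral_distr)
      have "AE x in \<mu> n. g (s x) = f x"
        using AE_K[of n] by eventually_elim (use C(2) p(3) g(2) in auto)
      then show "(\<integral>x. g (s x) \<partial>\<mu> n) = (\<integral>x. f x \<partial>\<mu> n)"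
        by (intro integral_cong_AE) auto
    qed auto
    moreover have "(\<integral>c. g c \<partial>L) = (\<integral>x. f x \<partial>\<nu>)"
      unfolding \<nu>_def
    proof (subst integral_distr)
      have "AE c in L. g c = f (p' c)"
        using L_C by eventually_elim (use g(2) in \<open>auto simp: p'_def\<close>)
      then show "(\<integral>c. g c \<partial>L) = (\<integral>c. f (p' c) \<partial>L)"
        by (intro integral_cong_AE) auto
    qed auto
    ultimately show "(\<lambda>n. \<integral>x. f x \<partial>\<mu> (r n)) \<longlonglongrightarrow> (\<integral>x. f x \<partial>\<nu>)"
      using int_conv[OF g(1,3)] by simp
  qed
qed

section \<open>Invariant measures as limits of averages\<close>

lemma invariant_set_funpow:
  assumes "T ` K \<subseteq> K" "x \<in> K"
  shows "(T ^^ n) x \<in> K"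
  using assms by (induction n) auto

text \<open>Averages of \<open>f \<circ> T\<close> and of \<open>f\<close> along an orbit differ
  only by two boundary terms divided by the number of summands, so every weak limit of the averaged
  laws is invariant. The convergence itself is part of the conclusion because it later identifies
  the marginals of the limit.\<close>

lemma krylov_bogolyubov:
  fixes K :: "'a::{complete_space, second_countable_topology} set"
  assumes K: "compact K" and T: "continuous_on UNIV T" "T ` K \<subseteq> K" and m: "prob_on K m"
  obtains r :: "nat \<Rightarrow> nat" and \<nu> where "strict_mono r" "prob_on K \<nu>" "distr \<nu> borel T = \<nu>"
    "\<And>f::'a \<Rightarrow> real. continuous_on UNIV f \<Longrightarrow> bounded (range f) \<Longrightarrow>
       (\<lambda>n. (\<Sum>j<Suc (r n). \<integral>x. f ((T ^^ j) x) \<partial>m) / real (Suc (r n))) \<longlonglongrightarrow> (\<integral>x. f x \<partial>\<nu>)"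
proof -
  have K_borel: "K \<in> sets borel" using K by (auto intro!: borel_closed compact_imp_closed)
  note pK = prob_on_iff_AE[OF K_borel]
  interpret m: prob_space m using m by (simp add: prob_on_def)
  have [measurable_cong]: "sets m = sets borel" using m by (simp add: prob_on_def)
  have mK: "AE x in m. x \<in> K" using m by (simp add: pK)
  have T_meas[measurable]: "T \<in> borel_measurable borel" using T(1) by (rule borel_measurable_continuous_onI)
  \<comment> \<open>The average of the laws of the iterates is realised as the law of
    \<open>(T ^^ j) x\<close> with \<open>j\<close> uniform on \<open>{..<Suc n}\<close> and
    \<open>x\<close> independent of \<open>j\<close> with law \<open>m\<close>. It is then a
    probability measure at once, and its integrals follow from Fubini's theorem.\<close>
  define U where "U n = measure_pmf (pmf_of_set {..<Suc n}) \<Otimes>\<^sub>M m" for n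
  define \<mu> where "\<mu> n = distr (U n) borel (\<lambda>(j, x). (T ^^ j) x)" for n
  have iter_meas: "(\<lambda>(j, x). (T ^^ j) x) \<in> U n \<rightarrow>\<^sub>M borel" for n
  proof -
    have "(\<lambda>(j, x). (T ^^ j) x) \<in> count_space UNIV \<Otimes>\<^sub>M m \<rightarrow>\<^sub>M borel"
      by (rule measurable_pair_measure_countable1) auto
    then show ?thesis
      unfolding U_def
      by (subst measurable_cong_sets[OF sets_pair_measure_cong[of _ "count_space UNIV" m m] refl]) auto
  qed
  have pU: "prob_space (U n)" for n
    unfolding U_def
    by (intro prob_space_pair prob_space_measure_pmf m.prob_space_axioms)
  have \<mu>_integral: "(\<integral>x. f x \<partial>\<mu> n) = (\<Sum>j<Suc n. \<integral>x. f ((T ^^ j) x) \<partial>m) / real (Suc n)"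
    if f[measurable]: "f \<in> borel_measurable borel" and B: "\<And>x. \<bar>f x\<bar> \<le> B" for f :: "'a \<Rightarrow> real" and B n
  proof -
    interpret P: pair_prob_space "measure_pmf (pmf_of_set {..<Suc n})" m
      by unfold_locales
    interpret Un: prob_space "U n" by (rule pU)
    have "integrable (U n) (\<lambda>z. f (case z of (j, x) \<Rightarrow> (T ^^ j) x))"
      by (rule Un.integrable_const_bound[of _ B]) (use B measurable_compose[OF iter_meas f] in auto)
    then have "(\<integral>z. f (case z of (j, x) \<Rightarrow> (T ^^ j) x) \<partial>U n)
        = (\<integral>j. (\<integral>x. f ((T ^^ j) x) \<partial>m) \<partial>measure_pmf (pmf_of_set {..<Suc n}))"
      unfolding U_def by (subst P.integral_fst'[symmetric]) auto
    also have "\<dots> = (\<Sum>j<Suc n. \<integral>x. f ((T ^^ j) x) \<partial>m) / real (Suc n)"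
      by (subst integral_pmf_of_set) auto
    finally show ?thesis
      unfolding \<mu>_def by (subst integral_distr[OF iter_meas]) auto
  qed
  have "prob_on K (\<mu> n)" for n
  proof -
    interpret P: pair_prob_space "measure_pmf (pmf_of_set {..<Suc n})" m
      by unfold_locales
    have "AE z in U n. snd z \<in> K"
      unfolding U_def using K_borel mK by (intro P.AE_pair_measure) auto
    then have "AE z in U n. (case z of (j, x) \<Rightarrow> (T ^^ j) x) \<in> K"
      by eventually_elim (auto intro: invariant_set_funpow[OF T(2)])
    then show ?thesis
      unfolding pK unfolding \<mu>_def
      using K_borel by (auto simp: AE_distr_iff[OF iter_meas] intro!: prob_space.prob_space_distr[OF pU] iter_meas)
  qed
  from prob_on_compact_imp_convergent_subseq[of K \<mu>, OF K this]
  obtain r \<nu> where r: "strict_mono r" and \<nu>: "prob_on K \<nu>"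
    and conv: "\<And>f::'a \<Rightarrow> real. continuous_on UNIV f \<Longrightarrow> bounded (range f) \<Longrightarrow>
       (\<lambda>n. \<integral>x. f x \<partial>\<mu> (r n)) \<longlonglongrightarrow> (\<integral>x. f x \<partial>\<nu>)"
    by blast
  have conv': "(\<lambda>n. (\<Sum>j<Suc (r n). \<integral>x. f ((T ^^ j) x) \<partial>m) / real (Suc (r n))) \<longlonglongrightarrow> (\<integral>x. f x \<partial>\<nu>)"
    if f: "continuous_on UNIV f" "bounded (range f)" for f :: "'a \<Rightarrow> real"
  proof -
    obtain B where "\<And>x. \<bar>f x\<bar> \<le> B" using f(2) by (auto simp: bounded_iff)
    then show ?thesis
      using conv[OF f] by (subst (asm) \<mu>_integral[OF borel_measurable_continuous_onI[OF f(1)]])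
  qed
  interpret \<nu>: prob_space \<nu> using \<nu> by (simp add: prob_on_def)
  have \<nu>_sets[measurable_cong]: "sets \<nu> = sets borel" using \<nu> by (simp add: prob_on_def)
  have "distr \<nu> borel T = \<nu>"
  proof (rule measure_eqI_lipschitz)
    fix f :: "'a \<Rightarrow> real" assume f: "1-lipschitz_on UNIV f" "\<And>x. \<bar>f x\<bar> \<le> 1"
    have cf: "continuous_on UNIV f" by (rule lipschitz_on_continuous_on[OF f(1)])
    have [measurable]: "f \<in> borel_measurable borel" using cf by (rule borel_measurable_continuous_onI)
    have c1: "(\<lambda>n. (\<Sum>j<Suc (r n). \<integral>x. f ((T ^^ j) x) \<partial>m) / real (Suc (r n))) \<longlonglongrightarrow> (\<integral>x. f x \<partial>\<nu>)"
      by (rule conv'[OF cf]) (use f(2) in \<open>auto simp: bounded_iff\<close>)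
    \<comment> \<open>Continuity of \<open>T\<close> makes \<open>f \<circ> T\<close> an admissible
      test function; its averages are those of \<open>f\<close> with the index raised by
      one.\<close>
    have c2: "(\<lambda>n. (\<Sum>j<Suc (r n). \<integral>x. f (T ((T ^^ j) x)) \<partial>m) / real (Suc (r n))) \<longlonglongrightarrow> (\<integral>x. f (T x) \<partial>\<nu>)"
      by (rule conv') (use f(2) continuous_on_compose2[OF cf T(1)] in \<open>auto simp: bounded_iff\<close>)
    define a where "a j = (\<integral>x. f ((T ^^ j) x) \<partial>m)" for j
    have a_bound: "\<bar>a j\<bar> \<le> 1" for j
    proof -
      have "\<bar>a j\<bar> \<le> (\<integral>x. \<bar>f ((T ^^ j) x)\<bar> \<partial>m)" unfolding a_def by (rule integral_abs_bound)
      also have "\<dots> \<le> (\<integral>x. 1 \<partial>m)"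
        by (intro integral_mono m.integrable_const_bound[of _ 1]) (use f(2) in auto)
      finally show ?thesis by (simp add: m.prob_space)
    qed
    \<comment> \<open>The two sums telescope. The remaining difference is at most 2 in absolute
      value, which division by \<open>Suc k\<close> sends to 0.\<close>
    have "(\<Sum>j<Suc k. \<integral>x. f (T ((T ^^ j) x)) \<partial>m) - (\<Sum>j<Suc k. a j) = a (Suc k) - a 0" for k
      using sum_lessThan_telescope[of a "Suc k"] by (simp add: sum_subtractf a_def)
    then have diff: "(\<Sum>j<Suc k. \<integral>x. f (T ((T ^^ j) x)) \<partial>m) / real (Suc k) - (\<Sum>j<Suc k. a j) / real (Suc k)
        = (a (Suc k) - a 0) / real (Suc k)" for k
      by (simp only: diff_divide_distrib[symmetric])
    have "(\<lambda>k. (a (Suc k) - a 0) / real (Suc k)) \<longlonglongrightarrow> 0"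
    proof (rule Lim_null_comparison)
      show "eventually (\<lambda>k. norm ((a (Suc k) - a 0) / real (Suc k)) \<le> 2 * inverse (real (Suc k))) sequentially"
      proof (intro always_eventually allI)
        fix k
        have "\<bar>a (Suc k) - a 0\<bar> \<le> 2" using a_bound[of "Suc k"] a_bound[of 0] by linarith
        then have "\<bar>a (Suc k) - a 0\<bar> * inverse (real (Suc k)) \<le> 2 * inverse (real (Suc k))"
          by (rule mult_right_mono) simp
        then show "norm ((a (Suc k) - a 0) / real (Suc k)) \<le> 2 * inverse (real (Suc k))"
          by (simp add: divide_inverse abs_mult del: of_nat_Suc)
      qed
      show "(\<lambda>k. 2 * inverse (real (Suc k))) \<longlonglongrightarrow> 0"
        using tendsto_mult_right_zero[OF LIMSEQ_inverse_real_of_nat, of 2] by simp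
    qed
    then have "(\<lambda>n. (a (Suc (r n)) - a 0) / real (Suc (r n))) \<longlonglongrightarrow> 0"
      using LIMSEQ_subseq_LIMSEQ[OF _ r] by (fastforce simp: o_def)
    moreover have "(\<lambda>n. (a (Suc (r n)) - a 0) / real (Suc (r n))) \<longlonglongrightarrow> (\<integral>x. f (T x) \<partial>\<nu>) - (\<integral>x. f x \<partial>\<nu>)"
      using tendsto_diff[OF c2 c1] unfolding diff[symmetric] by (simp add: a_def)
    ultimately have "(\<integral>x. f (T x) \<partial>\<nu>) = (\<integral>x. f x \<partial>\<nu>)"
      using LIMSEQ_unique by force
    then show "(\<integral>x. f x \<partial>distr \<nu> borel T) = (\<integral>x. f x \<partial>\<nu>)"
      by (subst integral_distr) auto
  qed (auto intro!: \<nu>.prob_space_distr \<nu>.prob_space_axioms \<nu>_sets)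
  with r \<nu> conv' that show ?thesis by blast
qed

section \<open>Averages and the dual Lipschitz distance\<close>

text \<open>The deviations are dominated by a geometric series, so their partial sums stay below
  \<open>C / (1 - q)\<close> with \<open>q = exp (- \<gamma>)\<close>, and the averages inherit the
  limit.\<close>

lemma mean_tendsto_of_exp_bound:
  fixes a :: "nat \<Rightarrow> real"
  assumes "C > 0" "\<gamma> > 0" and a: "\<And>j. \<bar>a j - l\<bar> \<le> C * exp (- \<gamma> * real j)"
  shows "(\<lambda>n. (\<Sum>j<Suc n. a j) / real (Suc n)) \<longlonglongrightarrow> l"
proof -
  define q where "q = exp (- \<gamma>)"
  have q: "0 < q" "q < 1" using \<open>\<gamma> > 0\<close> by (auto simp: q_def)
  have a': "\<bar>a j - l\<bar> \<le> C * q ^ j" for j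
    using a[of j] by (simp add: q_def exp_of_nat_mult[symmetric] mult.commute)
  have bound: "\<bar>(\<Sum>j<Suc n. a j - l)\<bar> \<le> C / (1 - q)" for n
  proof -
    have "\<bar>(\<Sum>j<Suc n. a j - l)\<bar> \<le> (\<Sum>j<Suc n. C * q ^ j)"
      by (rule order_trans[OF sum_abs]) (intro sum_mono a')
    also have "\<dots> = C * (\<Sum>j<Suc n. q ^ j)" by (rule sum_distrib_left[symmetric])
    also have "\<dots> \<le> C * (\<Sum>j. q ^ j)"
      using q \<open>C > 0\<close> by (intro mult_left_mono sum_le_suminf) (auto simp: summable_geometric)
    also have "\<dots> = C / (1 - q)" using q by (simp add: suminf_geometric)
    finally show ?thesis .
  qed
  have "(\<lambda>n. (\<Sum>j<Suc n. a j) / real (Suc n) - l) \<longlonglongrightarrow> 0"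
  proof (rule Lim_null_comparison)
    have "(\<Sum>j<Suc n. a j) / real (Suc n) - l = (\<Sum>j<Suc n. a j - l) / real (Suc n)" for n
      by (simp add: sum_subtractf field_simps)
    then show "eventually (\<lambda>n. norm ((\<Sum>j<Suc n. a j) / real (Suc n) - l) \<le> C / (1 - q) * inverse (real (Suc n))) sequentially"
      using mult_right_mono[OF bound, of "inverse (real (Suc _))"]
      by (intro always_eventually allI) (simp add: abs_mult divide_inverse del: sum.lessThan_Suc of_nat_Suc)
    show "(\<lambda>n. C / (1 - q) * inverse (real (Suc n))) \<longlonglongrightarrow> 0"
      using tendsto_mult_right_zero[OF LIMSEQ_inverse_real_of_nat] .
  qed
  then show ?thesis by (simp add: LIM_zero_iff)
qed

text \<open>A real supremum dominates its members only over a set bounded above. The bound here is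
  2, since both integrals are at most 1 in absolute value; full mass on \<open>X\<close> turns the
  set integrals of \<open>f\<close> into ordinary ones.\<close>

lemma dual_lip_dist_upper:
  fixes f :: "'a::metric_space \<Rightarrow> real"
  assumes X: "X \<in> sets borel" and \<mu>: "prob_on X \<mu>" and \<nu>: "prob_on X \<nu>"
    and f: "1-lipschitz_on UNIV f" "\<And>x. \<bar>f x\<bar> \<le> 1"
  shows "\<bar>(\<integral>x. f x \<partial>\<mu>) - (\<integral>x. f x \<partial>\<nu>)\<bar> \<le> dual_lip_dist X \<mu> \<nu>"
proof -
  have set_int: "(LINT x:X|m. f x) = (\<integral>x. f x \<partial>m)" if "prob_on X m" for m
  proof -
    have m: "sets m = sets borel" "AE x in m. x \<in> X"
      using that X by (auto simp: prob_on_iff_AE)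
    have "f \<in> borel_measurable m"
      using borel_measurable_continuous_onI[OF lipschitz_on_continuous_on[OF f(1)]]
      by (simp add: m(1) cong: measurable_cong_sets)
    moreover have "AE x in m. indicator X x *\<^sub>R f x = f x"
      using m(2) by eventually_elim simp
    ultimately show ?thesis
      unfolding set_lebesgue_integral_def using X m(1) by (intro integral_cong_AE) auto
  qed
  have bound: "\<bar>LINT x:X|m. g x\<bar> \<le> 1" if "prob_on X m" and g: "\<And>x. x \<in> X \<Longrightarrow> \<bar>g x\<bar> \<le> 1" for m and g :: "'a \<Rightarrow> real"
  proof -
    interpret prob_space m using that(1) by (simp add: prob_on_def)
    show ?thesis
    \<comment> \<open>Here \<open>g\<close> is an arbitrary function controlled only on
      \<open>X\<close>. If it is not integrable there, its integral is 0 by convention and the bound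
      still holds.\<close>
    proof (cases "integrable m (\<lambda>x. indicator X x *\<^sub>R g x)")
      case True
      have "\<bar>LINT x:X|m. g x\<bar> \<le> (\<integral>x. \<bar>indicator X x *\<^sub>R g x\<bar> \<partial>m)"
        unfolding set_lebesgue_integral_def by (rule integral_abs_bound)
      also have "\<dots> \<le> (\<integral>x. 1 \<partial>m)"
        using True by (intro integral_mono integrable_abs) (auto simp: indicator_def g)
      finally show ?thesis by (simp add: prob_space)
    qed (simp add: set_lebesgue_integral_def not_integrable_integral_eq)
  qed
  have "\<bar>(LINT x:X|\<mu>. f x) - (LINT x:X|\<nu>. f x)\<bar> \<le> dual_lip_dist X \<mu> \<nu>"
    unfolding dual_lip_dist_def
  proof (rule cSUP_upper)
    show "f \<in> {f. 1-lipschitz_on X f \<and> (\<forall>x\<in>X. \<bar>f x\<bar> \<le> 1)}"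
      using f lipschitz_on_subset[OF f(1), of X] by auto
    show "bdd_above ((\<lambda>f :: 'a \<Rightarrow> real. \<bar>(LINT x:X|\<mu>. f x) - (LINT x:X|\<nu>. f x)\<bar>) ` {f. 1-lipschitz_on X f \<and> (\<forall>x\<in>X. \<bar>f x\<bar> \<le> 1)})"
    proof (rule bdd_aboveI2)
      fix g :: "'a \<Rightarrow> real" assume "g \<in> {f. 1-lipschitz_on X f \<and> (\<forall>x\<in>X. \<bar>f x\<bar> \<le> 1)}"
      then show "\<bar>(LINT x:X|\<mu>. g x) - (LINT x:X|\<nu>. g x)\<bar> \<le> 2"
        using bound[OF \<mu>, of g] bound[OF \<nu>, of g] by (auto simp: abs_le_iff)
    qed
  qed
  then show ?thesis by (simp add: set_int \<mu> \<nu>)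
qed

section \<open>Supports and sets of full measure\<close>

lemma closed_msupport: "closed (msupport \<mu>)"
proof -
  have "\<exists>T. open T \<and> x \<in> T \<and> T \<subseteq> - msupport \<mu>" if x: "x \<in> - msupport \<mu>" for x
  proof -
    obtain U where "open U" "x \<in> U" "\<not> emeasure \<mu> U > 0"
      using x by (auto simp: msupport_def)
    then show ?thesis by (intro exI[of _ U]) (auto simp: msupport_def)
  qed
  then show ?thesis
    unfolding closed_def by (subst open_subopen) blast
qed

text \<open>By second countability the complement of the support is covered by countably many basis
  sets of measure 0.\<close>

lemma AE_msupport:
  fixes \<mu> :: "'a::second_countable_topology measure"
  assumes "sets \<mu> = sets borel"
  shows "AE x in \<mu>. x \<in> msupport \<mu>"
proof -
  obtain \<B> :: "'a set set" where \<B>: "countable \<B>" "topological_basis \<B>"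
    using ex_countable_basis by blast
  define \<N> where "\<N> = {b \<in> \<B>. emeasure \<mu> b = 0}"
  have "AE x in \<mu>. \<forall>b\<in>\<N>. x \<notin> b"
  proof (subst AE_ball_countable)
    show "countable \<N>" unfolding \<N>_def using \<B>(1) by simp
    show "\<forall>b\<in>\<N>. AE x in \<mu>. x \<notin> b"
      using assms topological_basis_open[OF \<B>(2)] by (auto simp: \<N>_def null_sets_def intro!: AE_not_in)
  qed
  then show ?thesis
  proof eventually_elim
    case (elim x)
    have "emeasure \<mu> U > 0" if "open U" "x \<in> U" for U
    proof (rule ccontr)
      assume "\<not> emeasure \<mu> U > 0"
      moreover obtain b where "b \<in> \<B>" "x \<in> b" "b \<subseteq> U"
        using topological_basisE[OF \<B>(2) \<open>open U\<close> \<open>x \<in> U\<close>] .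
      ultimately have "b \<in> \<N>"
        using emeasure_mono[of b U \<mu>] assms that by (auto simp: \<N>_def not_gr_zero)
      then show False using elim \<open>x \<in> b\<close> by auto
    qed
    then show ?case by (simp add: msupport_def)
  qed
qed

text \<open>Passing to a subset of full measure leaves image laws unchanged; this allows almost sure
  properties to be turned into properties of every sample point.\<close>

lemma distr_restrict_space:
  assumes A: "A \<in> sets M" "AE x in M. x \<in> A" and g: "g \<in> M \<rightarrow>\<^sub>M Y"
  shows "distr (restrict_space M A) Y g = distr M Y g"
proof (rule measure_eqI)
  fix B assume "B \<in> sets (distr (restrict_space M A) Y g)"
  then have B: "B \<in> sets Y" by simp
  have [simp]: "space (restrict_space M A) = A" using A(1) by (rule space_restrict_space2)
  have "A \<subseteq> space M" using A(1) by (rule sets.sets_into_space)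
  have "emeasure (distr (restrict_space M A) Y g) B = emeasure (restrict_space M A) (g -` B \<inter> A)"
    using B g by (subst emeasure_distr) (auto intro: measurable_restrict_space1)
  also have "\<dots> = emeasure M (g -` B \<inter> A)"
    using A(1) \<open>A \<subseteq> space M\<close> by (subst emeasure_restrict_space) auto
  also have "\<dots> = emeasure M (g -` B \<inter> space M)"
  proof (rule emeasure_eq_AE)
    show "AE x in M. x \<in> g -` B \<inter> A \<longleftrightarrow> x \<in> g -` B \<inter> space M"
      using A(2) AE_space by eventually_elim auto
    have *: "g -` B \<inter> space M \<in> sets M" using B g by (rule measurable_sets[rotated])
    then show "g -` B \<inter> space M \<in> sets M" .
    have "g -` B \<inter> A = g -` B \<inter> space M \<inter> A" using \<open>A \<subseteq> space M\<close> by auto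
    then show "g -` B \<inter> A \<in> sets M" using * A(1) by auto
  qed
  also have "\<dots> = emeasure (distr M Y g) B"
    using B g by (subst emeasure_distr) auto
  finally show "emeasure (distr (restrict_space M A) Y g) B = emeasure (distr M Y g) B" .
qed simp

section \<open>Path space and the skew product\<close>

text \<open>This is Tychonoff's theorem, as the topology of the function type is the product
  topology.\<close>

lemma compact_PiE_UNIV:
  fixes K :: "'b::topological_space set"
  assumes "compact K"
  shows "compact {w::'a \<Rightarrow> 'b. \<forall>k. w k \<in> K}"
proof -
  have "{w::'a \<Rightarrow> 'b. \<forall>k. w k \<in> K} = (\<Pi>\<^sub>E k\<in>UNIV. K)" by (auto simp: PiE_UNIV_domain)
  moreover have "compactin (product_topology (\<lambda>_. euclidean) UNIV) (\<Pi>\<^sub>E k\<in>(UNIV::'a set). K)"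
    using assms by (auto simp: compactin_PiE)
  ultimately show ?thesis by (simp add: euclidean_product_topology)
qed

text \<open>The state is updated with coordinate 1 of the unshifted path. The first \<open>n\<close>
  iterates therefore consume the coordinates 1 to \<open>n\<close>, in agreement with the indexing
  of \<open>traj\<close>.\<close>

definition skew_map :: "('h \<times> 'e \<Rightarrow> 'h) \<Rightarrow> 'h \<times> (int \<Rightarrow> 'e) \<Rightarrow> 'h \<times> (int \<Rightarrow> 'e)"
  where "skew_map S z = (S (fst z, snd z 1), \<lambda>k. snd z (k + 1))"

lemma snd_skew_map_funpow: "snd ((skew_map S ^^ n) z) = (\<lambda>k. snd z (k + int n))"
proof (induction n)
  case (Suc n)
  have "snd ((skew_map S ^^ Suc n) z) = (\<lambda>k. snd ((skew_map S ^^ n) z) (k + 1))"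
    by (simp add: skew_map_def[of S "(skew_map S ^^ n) z"])
  then show ?case by (simp add: Suc algebra_simps)
qed simp

lemma fst_skew_map_funpow_Suc:
  "fst ((skew_map S ^^ Suc n) z) = S (fst ((skew_map S ^^ n) z), snd z (int (Suc n)))"
  by (simp add: skew_map_def snd_skew_map_funpow)

lemma fst_skew_map_funpow: "fst ((skew_map S ^^ n) z) = traj S (fst z) (\<lambda>j. snd z (int j)) n"
  by (induction n) (simp_all add: fst_skew_map_funpow_Suc del: funpow.simps(2))

lemma continuous_on_skew_map:
  fixes S :: "'h::topological_space \<times> 'e::topological_space \<Rightarrow> 'h"
  assumes "continuous_on UNIV S"
  shows "continuous_on UNIV (skew_map S)"
proof -
  have coord: "continuous_on UNIV (\<lambda>z :: 'h \<times> (int \<Rightarrow> 'e). snd z k)" for k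
    by (rule continuous_on_product_then_coordinatewise) (intro continuous_on_snd continuous_on_id)
  have "continuous_on UNIV (\<lambda>z :: 'h \<times> (int \<Rightarrow> 'e). S (fst z, snd z 1))"
    by (rule continuous_on_compose2[OF assms])
      (auto intro!: continuous_on_Pair coord continuous_on_fst continuous_on_id)
  moreover have "continuous_on UNIV (\<lambda>(z :: 'h \<times> (int \<Rightarrow> 'e)) k. snd z (k + 1))"
    by (rule continuous_on_coordinatewise_then_product) (rule coord)
  ultimately show ?thesis
    unfolding skew_map_def by (rule continuous_on_Pair)
qed

section \<open>Borel structure and laws of sequences\<close>

lemma measurable_PiM_UNIV_borel:
  assumes "\<And>i. (\<lambda>x. f x i) \<in> borel_measurable M"
  shows "f \<in> M \<rightarrow>\<^sub>M (\<Pi>\<^sub>M i\<in>UNIV. borel)"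
  by (rule measurable_PiM_single') (use assms in auto)

text \<open>For countably many second countable factors the Borel sets of the product topology are
  exactly the product sigma-algebra, which is generated by the coordinates.\<close>

lemma borel_measurable_coordinatewise:
  fixes f :: "'a \<Rightarrow> 'i::countable \<Rightarrow> 'b::second_countable_topology"
  assumes "\<And>i. (\<lambda>x. f x i) \<in> borel_measurable M"
  shows "f \<in> borel_measurable M"
  using measurable_PiM_UNIV_borel[of f M, OF assms]
  by (simp only: measurable_cong_sets[OF refl sets_PiM_equal_borel])

text \<open>Stationarity is stated for laws on the product sigma-algebra, whereas weak convergence
  is treated for Borel measures; this passes between the two.\<close>

lemma distr_PiM_UNIV_eq_borel:
  fixes f :: "'a \<Rightarrow> 'i::countable \<Rightarrow> 'b::second_countable_topology"
  shows "distr M (\<Pi>\<^sub>M i\<in>UNIV. borel) f = distr M borel f"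
  by (rule distr_cong) (simp_all add: sets_PiM_equal_borel)

lemma stationary_process_distr_shift:
  fixes \<eta> :: "int \<Rightarrow> 'w \<Rightarrow> 'e::second_countable_topology"
  assumes "stationary_process M \<eta>"
  shows "distr M borel (\<lambda>\<omega> k. \<eta> (k + s) \<omega>) = distr M borel (\<lambda>\<omega> k. \<eta> k \<omega>)"
proof -
  have "distr M (\<Pi>\<^sub>M t\<in>UNIV. borel) (\<lambda>\<omega> k. \<eta> (k + s) \<omega>) = distr M (\<Pi>\<^sub>M t\<in>UNIV. borel) (\<lambda>\<omega> k. \<eta> k \<omega>)"
    using assms unfolding stationary_process_def by blast
  then show ?thesis
    by (simp only: distr_PiM_UNIV_eq_borel)
qed

lemma C2_bdd_on_bounded_continuous:
  assumes "C2_bdd_on_bounded f"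
  shows "continuous_on UNIV f"
  using assms unfolding C2_bdd_on_bounded_def
  by (auto intro!: continuous_at_imp_continuous_on dest: has_derivative_continuous)

text \<open>The counterpart of \<open>past\<close> for a single path. As a function of the path it
  is continuous, so closed conditions on the past define closed sets of paths.\<close>

definition seq_past :: "(int \<Rightarrow> 'e) \<Rightarrow> int \<Rightarrow> nat \<Rightarrow> 'e"
  where "seq_past w k = (\<lambda>i. w (k - int i))"

lemma past_eq_seq_past: "past \<eta> k \<omega> = seq_past (\<lambda>j. \<eta> j \<omega>) k"
  by (simp add: past_def seq_past_def)

lemma continuous_on_seq_past: "continuous_on A (\<lambda>w. seq_past w k)"
  unfolding seq_past_def
  by (rule continuous_on_coordinatewise_then_product)
    (rule continuous_on_product_then_coordinatewise[OF continuous_on_id])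

section \<open>Construction of the stationary solution\<close>

theorem proposition3p6:
  fixes M :: "'w measure"
    and \<eta> :: "int \<Rightarrow> 'w \<Rightarrow> 'e::{banach, second_countable_topology}"
    and S :: "'h::{real_inner, complete_space, second_countable_topology} \<times> 'e \<Rightarrow> 'h"
    and X :: "'h set"
    and K :: "'e set"
    and \<E> :: "(nat \<Rightarrow> 'e) set"
    and Q :: "(nat \<Rightarrow> 'e) \<Rightarrow> 'e measure"
    and \<iota> :: real
    and \<mu> :: "'h measure"
  assumes "prob_space M"
    and "stationary_process M \<eta>"
    and "K = msupport (distr M borel (\<eta> 0))"
    and "compact K"
    and "C2_bdd_on_bounded S"
    and "compact X"
    and "S ` (X \<times> K) \<subseteq> X"
    and "\<iota> > 1"
    and "\<E> = msupport (distr M borel (past \<eta> 0))"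
    and "cond_law M (past \<eta> 0) (\<eta> 1) Q"
    and "hyp_SF \<iota> K \<E> Q"
    and "hyp_GD S"
    and "hyp_ALC S X K"
    and "hyp_DLP' \<iota> \<E> Q"
    and "hyp_SRZ \<E> Q"
    and "limiting_measure M \<eta> S X \<mu>"
  shows "\<exists>(N :: ('h \<times> (int \<Rightarrow> 'e)) measure) (\<eta>h :: int \<Rightarrow> 'h \<times> (int \<Rightarrow> 'e) \<Rightarrow> 'e)
      (uh :: nat \<Rightarrow> 'h \<times> (int \<Rightarrow> 'e) \<Rightarrow> 'h).
    prob_space N \<and>
    (\<forall>k. \<eta>h k \<in> borel_measurable N) \<and>
    distr N (\<Pi>\<^sub>M k\<in>UNIV. borel) (\<lambda>\<omega> k. \<eta>h k \<omega>) = distr M (\<Pi>\<^sub>M k\<in>UNIV. borel) (\<lambda>\<omega> k. \<eta> k \<omega>) \<and>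
    (\<forall>k. uh k \<in> borel_measurable N) \<and>
    (\<forall>\<omega>\<in>space N. \<forall>k. uh k \<omega> \<in> X \<and> past \<eta>h (int k) \<omega> \<in> \<E>) \<and>
    (\<forall>\<omega>\<in>space N. \<forall>k\<ge>1. uh k \<omega> = S (uh (k - 1) \<omega>, \<eta>h (int k) \<omega>)) \<and>
    stationary_process N (\<lambda>k \<omega>. (uh k \<omega>, past \<eta>h (int k) \<omega>)) \<and>
    (\<forall>k. distr N borel (uh k) = \<mu>)"
proof -
  interpret M: prob_space M by fact
  have \<eta>_meas[measurable]: "\<eta> k \<in> borel_measurable M" for k
    using assms(2) by (simp add: stationary_process_def)
  define path where "path \<omega> = (\<lambda>k. \<eta> k \<omega>)" for \<omega>
  have path_meas[measurable]: "path \<in> borel_measurable M"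
    unfolding path_def by (rule borel_measurable_coordinatewise) simp
  define P where "P = distr M borel path"
  have shift: "distr M borel (\<lambda>\<omega> k. \<eta> (k + s) \<omega>) = P" for s
    unfolding P_def path_def by (rule stationary_process_distr_shift[OF assms(2)])
  have shift_meas: "(\<lambda>\<omega> j. \<eta> (j + k) \<omega>) \<in> borel_measurable M" for k
    by (rule borel_measurable_coordinatewise) simp
  have [simp]: "sets P = sets borel" by (simp add: P_def)
  define T where "T = skew_map S"
  have T_cont: "continuous_on UNIV T"
    unfolding T_def by (rule continuous_on_skew_map[OF C2_bdd_on_bounded_continuous[OF assms(5)]])
  have T_meas[measurable]: "T \<in> borel_measurable borel"
    using T_cont by (rule borel_measurable_continuous_onI)
  have seq_past_meas[measurable]: "(\<lambda>w. seq_past w k) \<in> borel_measurable borel" for k :: int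
    by (rule borel_measurable_continuous_onI[OF continuous_on_seq_past])
  have coord_meas[measurable]: "(\<lambda>w. w k) \<in> borel_measurable borel" for k :: int
    by (rule borel_measurable_continuous_onI)
      (rule continuous_on_product_then_coordinatewise[OF continuous_on_id])

  \<comment> \<open>A compact set carrying almost every noise path\<close>
  \<comment> \<open>The pasts at all times, not only at time 0, are required to lie in
    \<open>\<E>\<close>, which makes \<open>W\<close> invariant under the shift.\<close>
  define W where "W = {w :: int \<Rightarrow> 'e. (\<forall>k. w k \<in> K) \<and> (\<forall>k. seq_past w k \<in> \<E>)}"
  have "closed \<E>" unfolding assms(9) by (rule closed_msupport)
  have "compact W"
  proof -
    have "closed {w :: int \<Rightarrow> 'e. \<forall>k. seq_past w k \<in> \<E>}"
      using closed_vimage[OF \<open>closed \<E>\<close> continuous_on_seq_past]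
      by (intro closed_Collect_all) (simp add: vimage_def)
    then have "compact ({w :: int \<Rightarrow> 'e. \<forall>k. w k \<in> K} \<inter> {w. \<forall>k. seq_past w k \<in> \<E>})"
      by (intro compact_Int_closed compact_PiE_UNIV assms(4))
    then show ?thesis by (simp add: W_def Collect_conj_eq)
  qed
  have W_borel[measurable]: "W \<in> sets borel"
    using \<open>compact W\<close> by (auto intro: borel_closed compact_imp_closed)
  have P_W: "AE \<omega> in M. path \<omega> \<in> W"
  proof -
    have "AE \<omega> in M. \<eta> k \<omega> \<in> K" for k
    proof -
      \<comment> \<open>The value at any time \<open>k\<close>, negative times included, is
        coordinate 0 of the path shifted by \<open>k\<close>, so stationarity gives it the law of
        \<open>\<eta> 0\<close>, whose support is \<open>K\<close>.\<close>
      have "distr M borel (\<eta> k) = distr (distr M borel (\<lambda>\<omega> j. \<eta> (j + k) \<omega>)) borel (\<lambda>w. w 0)"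
        by (subst distr_distr[OF coord_meas shift_meas]) (simp add: o_def)
      also have "\<dots> = distr (distr M borel (\<lambda>\<omega> j. \<eta> (j + 0) \<omega>)) borel (\<lambda>w. w 0)"
        by (simp only: shift)
      also have "\<dots> = distr M borel (\<eta> 0)"
        by (subst distr_distr[OF coord_meas shift_meas]) (simp add: o_def)
      finally have *: "distr M borel (\<eta> k) = distr M borel (\<eta> 0)" .
      have "AE x in distr M borel (\<eta> k). x \<in> K"
        unfolding * assms(3) by (rule AE_msupport) simp
      then show ?thesis
        using assms(4) by (subst (asm) AE_distr_iff) (auto intro!: borel_closed compact_imp_closed)
    qed
    moreover have "AE \<omega> in M. seq_past (path \<omega>) k \<in> \<E>" for k
    proof -
      \<comment> \<open>Likewise the past at time \<open>k\<close> is the past at time 0 of the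
        shifted path, so its law does not depend on \<open>k\<close> and has support
        \<open>\<E>\<close>.\<close>
      have *: "distr M borel (\<lambda>\<omega>. seq_past (path \<omega>) k)
          = distr (distr M borel (\<lambda>\<omega> j. \<eta> (j + k) \<omega>)) borel (\<lambda>w. seq_past w 0)" for k
      proof (subst distr_distr[OF seq_past_meas shift_meas])
        show "distr M borel (\<lambda>\<omega>. seq_past (path \<omega>) k)
            = distr M borel ((\<lambda>w. seq_past w 0) \<circ> (\<lambda>\<omega> j. \<eta> (j + k) \<omega>))"
          by (rule distr_cong) (auto simp: seq_past_def path_def algebra_simps)
      qed
      have "AE x in distr M borel (\<lambda>\<omega>. seq_past (path \<omega>) 0). x \<in> \<E>"
        using AE_msupport[of "distr M borel (past \<eta> 0)"]
        unfolding assms(9) past_eq_seq_past[abs_def] path_def by simp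
      then have "AE x in distr M borel (\<lambda>\<omega>. seq_past (path \<omega>) k). x \<in> \<E>"
        unfolding * shift .
      then show ?thesis
        using \<open>closed \<E>\<close> by (subst (asm) AE_distr_iff) (auto intro: borel_closed)
    qed
    ultimately have "AE \<omega> in M. (\<forall>k. \<eta> k \<omega> \<in> K) \<and> (\<forall>k. seq_past (path \<omega>) k \<in> \<E>)"
      by (simp add: AE_all_countable)
    then show ?thesis by (simp add: W_def path_def)
  qed

  \<comment> \<open>An invariant measure of the skew product\<close>
  have X_borel[measurable]: "X \<in> sets borel"
    using assms(6) by (auto intro: borel_closed compact_imp_closed)
  have \<mu>: "prob_on X \<mu>" using assms(16) by (simp add: limiting_measure_def)
  obtain C \<gamma> where C: "C > 0" "\<gamma> > 0"
    and lim: "\<And>u k. u \<in> X \<Longrightarrow>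
       dual_lip_dist X (distr M borel (\<lambda>\<omega>. traj S u (\<lambda>j. \<eta> (int j) \<omega>) k)) \<mu> \<le> C * exp (- \<gamma> * real k)"
    using assms(16) unfolding limiting_measure_def by blast
  have "X \<noteq> {}" using \<mu> by (auto simp: prob_on_def)
  then obtain u0 where "u0 \<in> X" by auto

  define Z where "Z = X \<times> W"
  have "compact Z" unfolding Z_def by (intro compact_Times assms(6) \<open>compact W\<close>)
  then have Z_borel[measurable]: "Z \<in> sets borel" by (auto intro: borel_closed compact_imp_closed)
  note pZ = prob_on_iff_AE[OF Z_borel] and pX = prob_on_iff_AE[OF X_borel]
  have T_Z: "T ` Z \<subseteq> Z"
  proof -
    have "seq_past (\<lambda>k. w (k + 1)) k = seq_past w (k + 1)" for w :: "int \<Rightarrow> 'e" and k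
      by (simp add: seq_past_def algebra_simps)
    then show ?thesis using assms(7) by (auto simp: Z_def W_def T_def skew_map_def)
  qed
  \<comment> \<open>The state starts at a fixed point of \<open>X\<close>, so its later laws are
    those controlled by \<open>lim\<close>, while the noise path has its own stationary law.\<close>
  define m where "m = distr M borel (\<lambda>\<omega>. (u0, path \<omega>))"
  have start_meas[measurable]: "(\<lambda>\<omega>. (u0, path \<omega>)) \<in> borel_measurable M"
    by (rule borel_measurable_Pair) simp_all
  have m: "prob_on Z m"
    unfolding pZ unfolding m_def
  proof (intro conjI M.prob_space_distr start_meas sets_distr)
    show "AE x in distr M borel (\<lambda>\<omega>. (u0, path \<omega>)). x \<in> Z"
    proof (subst AE_distr_iff[OF start_meas])
      show "AE \<omega> in M. (u0, path \<omega>) \<in> Z"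
        using P_W by eventually_elim (simp add: Z_def \<open>u0 \<in> X\<close>)
    qed simp
  qed
  obtain r \<nu> where r: "strict_mono r" and \<nu>: "prob_on Z \<nu>" and inv: "distr \<nu> borel T = \<nu>"
    and conv: "\<And>f::_ \<Rightarrow> real. continuous_on UNIV f \<Longrightarrow> bounded (range f) \<Longrightarrow>
       (\<lambda>n. (\<Sum>j<Suc (r n). \<integral>x. f ((T ^^ j) x) \<partial>m) / real (Suc (r n))) \<longlonglongrightarrow> (\<integral>x. f x \<partial>\<nu>)"
    by (rule krylov_bogolyubov[OF \<open>compact Z\<close> T_cont T_Z m]) blast
  interpret \<nu>: prob_space \<nu> using \<nu> by (simp add: prob_on_def)
  have \<nu>_sets[measurable_cong, simp]: "sets \<nu> = sets borel" using \<nu> by (simp add: prob_on_def)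
  have \<nu>_Z: "AE z in \<nu>. z \<in> Z" using \<nu> by (simp add: pZ)
  have fst_meas[measurable]: "fst \<in> borel_measurable (borel :: ('h \<times> (int \<Rightarrow> 'e)) measure)"
    and snd_meas[measurable]: "snd \<in> borel_measurable (borel :: ('h \<times> (int \<Rightarrow> 'e)) measure)"
    by (rule borel_measurable_continuous_onI, rule continuous_on_fst[OF continuous_on_id],
        rule borel_measurable_continuous_onI, rule continuous_on_snd[OF continuous_on_id])
  have \<nu>_meas: "g \<in> \<nu> \<rightarrow>\<^sub>M Y" if "g \<in> borel \<rightarrow>\<^sub>M Y" for g and Y :: "'y measure"
    using that by (simp only: measurable_cong_sets[OF \<nu>_sets refl])
  have T_pow_meas: "T ^^ n \<in> borel_measurable \<nu>" for n
    by (rule \<nu>_meas[OF measurable_compose_n[OF T_meas]])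
  have T_fst_meas: "(\<lambda>z. fst ((T ^^ n) z)) \<in> borel_measurable borel"
    and T_snd_meas: "(\<lambda>z. snd ((T ^^ n) z)) \<in> borel_measurable borel" for n
    using measurable_compose[OF measurable_compose_n[OF T_meas] fst_meas]
      measurable_compose[OF measurable_compose_n[OF T_meas] snd_meas] by blast+
  have inv_pow: "distr \<nu> borel (T ^^ n) = \<nu>" for n
  proof (induction n)
    case 0
    show ?case using distr_id2[of borel \<nu>] by (simp add: id_def)
  next
    case (Suc n)
    have "distr \<nu> borel (T ^^ Suc n) = distr (distr \<nu> borel (T ^^ n)) borel T"
      by (subst distr_distr[OF T_meas]) (simp_all add: T_pow_meas o_def)
    then show ?case by (simp only: Suc inv)
  qed

  \<comment> \<open>Marginals of the invariant measure\<close>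
  \<comment> \<open>The same averages are evaluated twice: the exponential bound sends them to the
    integral against \<open>\<mu>\<close>, and weak convergence along \<open>r\<close> sends them to
    the integral against the first marginal of \<open>\<nu>\<close>.\<close>
  have fst_\<nu>: "distr \<nu> borel fst = \<mu>"
  proof (rule measure_eqI_lipschitz)
    fix f :: "'h \<Rightarrow> real" assume f: "1-lipschitz_on UNIV f" "\<And>x. \<bar>f x\<bar> \<le> 1"
    have cf: "continuous_on UNIV f" by (rule lipschitz_on_continuous_on[OF f(1)])
    have f_meas[measurable]: "f \<in> borel_measurable borel" using cf by (rule borel_measurable_continuous_onI)
    define u where "u j \<omega> = traj S u0 (\<lambda>i. \<eta> (int i) \<omega>) j" for j \<omega>
    have u: "u j \<omega> = fst ((T ^^ j) (u0, path \<omega>))" for j \<omega>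
      by (simp add: u_def T_def fst_skew_map_funpow path_def)
    have u_meas[measurable]: "u j \<in> borel_measurable M" for j
      unfolding u[abs_def]
      by (rule measurable_compose[OF measurable_compose[OF start_meas measurable_compose_n[OF T_meas]] fst_meas])
    have prob_u: "prob_on X (distr M borel (u j))" for j
      unfolding pX
    proof (intro conjI M.prob_space_distr sets_distr u_meas)
      have "AE \<omega> in M. u j \<omega> \<in> X"
        using P_W
      proof eventually_elim
        case (elim \<omega>)
        then have "(T ^^ j) (u0, path \<omega>) \<in> Z"
          using \<open>u0 \<in> X\<close> by (intro invariant_set_funpow[OF T_Z]) (simp add: Z_def)
        then show ?case by (auto simp: u Z_def mem_Times_iff)
      qed
      then show "AE x in distr M borel (u j). x \<in> X"
        by (subst AE_distr_iff[OF u_meas]) simp_all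
    qed
    have lim_u: "dual_lip_dist X (distr M borel (u j)) \<mu> \<le> C * exp (- \<gamma> * real j)" for j
      unfolding u_def[abs_def] by (rule lim[OF \<open>u0 \<in> X\<close>])
    have "\<bar>(\<integral>x. f x \<partial>distr M borel (u j)) - (\<integral>x. f x \<partial>\<mu>)\<bar> \<le> C * exp (- \<gamma> * real j)" for j
      by (rule order_trans[OF dual_lip_dist_upper[OF X_borel prob_u \<mu> f] lim_u])
    moreover have "(\<integral>x. f x \<partial>distr M borel (u j)) = (\<integral>z. f (fst ((T ^^ j) z)) \<partial>m)" for j
      unfolding m_def
      by (subst integral_distr[OF u_meas f_meas], subst integral_distr[OF start_meas])
        (simp_all add: u T_fst_meas f_meas measurable_compose[OF _ f_meas])
    ultimately have "(\<lambda>n. (\<Sum>j<Suc n. \<integral>z. f (fst ((T ^^ j) z)) \<partial>m) / real (Suc n)) \<longlonglongrightarrow> (\<integral>x. f x \<partial>\<mu>)"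
      by (intro mean_tendsto_of_exp_bound[OF C]) simp
    from LIMSEQ_subseq_LIMSEQ[OF this r]
    have "(\<lambda>n. (\<Sum>j<Suc (r n). \<integral>z. f (fst ((T ^^ j) z)) \<partial>m) / real (Suc (r n))) \<longlonglongrightarrow> (\<integral>x. f x \<partial>\<mu>)"
      by (simp add: o_def)
    moreover have "(\<lambda>n. (\<Sum>j<Suc (r n). \<integral>z. f (fst ((T ^^ j) z)) \<partial>m) / real (Suc (r n))) \<longlonglongrightarrow> (\<integral>z. f (fst z) \<partial>\<nu>)"
      by (rule conv, rule continuous_on_compose2[OF cf continuous_on_fst[OF continuous_on_id]])
        (use f(2) in \<open>auto simp: bounded_iff\<close>)
    ultimately have "(\<integral>x. f x \<partial>\<mu>) = (\<integral>z. f (fst z) \<partial>\<nu>)" by (rule LIMSEQ_unique)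
    then show "(\<integral>x. f x \<partial>distr \<nu> borel fst) = (\<integral>x. f x \<partial>\<mu>)"
      by (simp only: integral_distr[OF \<nu>_meas[OF fst_meas] f_meas])
  next
    show "prob_space (distr \<nu> borel fst)" by (rule \<nu>.prob_space_distr[OF \<nu>_meas[OF fst_meas]])
  qed (use \<mu> in \<open>simp_all add: prob_on_def\<close>)

  \<comment> \<open>Every iterate only shifts the path, and \<open>P\<close> is shift invariant, so
    each average is already the integral against \<open>P\<close>.\<close>
  have snd_\<nu>: "distr \<nu> borel snd = P"
  proof (rule measure_eqI_lipschitz)
    fix f :: "(int \<Rightarrow> 'e) \<Rightarrow> real" assume f: "1-lipschitz_on UNIV f" "\<And>x. \<bar>f x\<bar> \<le> 1"
    have cf: "continuous_on UNIV f" by (rule lipschitz_on_continuous_on[OF f(1)])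
    have f_meas[measurable]: "f \<in> borel_measurable borel" using cf by (rule borel_measurable_continuous_onI)
    have "(\<integral>z. f (snd ((T ^^ j) z)) \<partial>m) = (\<integral>w. f w \<partial>P)" for j
    proof -
      have "(\<integral>z. f (snd ((T ^^ j) z)) \<partial>m) = (\<integral>\<omega>. f (\<lambda>k. \<eta> (k + int j) \<omega>) \<partial>M)"
        unfolding m_def
        by (subst integral_distr[OF start_meas measurable_compose[OF T_snd_meas f_meas]])
          (simp add: T_def snd_skew_map_funpow path_def)
      also have "\<dots> = (\<integral>w. f w \<partial>distr M borel (\<lambda>\<omega> k. \<eta> (k + int j) \<omega>))"
        by (rule integral_distr[OF shift_meas f_meas, symmetric])
      finally show ?thesis by (simp only: shift)
    qed
    moreover have "(\<lambda>n. (\<Sum>j<Suc (r n). \<integral>z. f (snd ((T ^^ j) z)) \<partial>m) / real (Suc (r n))) \<longlonglongrightarrow> (\<integral>z. f (snd z) \<partial>\<nu>)"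
      by (rule conv, rule continuous_on_compose2[OF cf continuous_on_snd[OF continuous_on_id]])
        (use f(2) in \<open>auto simp: bounded_iff\<close>)
    ultimately have "(\<integral>z. f (snd z) \<partial>\<nu>) = (\<integral>w. f w \<partial>P)"
      by (simp add: LIMSEQ_const_iff del: of_nat_Suc)
    then show "(\<integral>x. f x \<partial>distr \<nu> borel snd) = (\<integral>x. f x \<partial>P)"
      by (simp only: integral_distr[OF \<nu>_meas[OF snd_meas] f_meas])
  next
    show "prob_space (distr \<nu> borel snd)" by (rule \<nu>.prob_space_distr[OF \<nu>_meas[OF snd_meas]])
    show "prob_space P" unfolding P_def by (rule M.prob_space_distr[OF path_meas])
  qed simp_all

  \<comment> \<open>The process on the canonical space\<close>
  \<comment> \<open>Membership in \<open>X\<close> and \<open>\<E>\<close> is demanded at every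
    sample point, so \<open>\<nu>\<close> is restricted to \<open>Z\<close>, an invariant set of
    full measure.\<close>
  define N where "N = restrict_space \<nu> Z"
  have N_space: "space N = Z" unfolding N_def by (rule space_restrict_space2) simp
  have N_distr: "distr N Y g = distr \<nu> Y g" if "g \<in> \<nu> \<rightarrow>\<^sub>M Y" for g and Y :: "'y measure"
    unfolding N_def by (rule distr_restrict_space[OF _ \<nu>_Z that]) simp
  have N_meas: "g \<in> N \<rightarrow>\<^sub>M Y" if "g \<in> \<nu> \<rightarrow>\<^sub>M Y" for g and Y :: "'y measure"
    unfolding N_def by (rule measurable_restrict_space1[OF that])
  \<comment> \<open>The noise is the coordinate process over all integers, and the state is the
    first component of the orbit of \<open>T\<close>.\<close>
  define \<eta>h where "\<eta>h k z = snd z k" for k :: int and z :: "'h \<times> (int \<Rightarrow> 'e)"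
  define uh where "uh k z = fst ((T ^^ k) z)" for k z
  define V where "V k z = (uh k z, past \<eta>h (int k) z)" for k z
  have past_\<eta>h: "past \<eta>h k z = seq_past (snd z) k" for k z
    by (simp add: past_eq_seq_past \<eta>h_def)
  have \<eta>h_meas: "\<eta>h k \<in> borel_measurable \<nu>" for k
    unfolding \<eta>h_def by (rule \<nu>_meas[OF measurable_compose[OF snd_meas coord_meas]])
  have uh_meas: "uh k \<in> borel_measurable \<nu>" for k
    unfolding uh_def by (rule \<nu>_meas[OF T_fst_meas])
  have V_meas: "V k \<in> borel_measurable \<nu>" for k
    unfolding V_def past_\<eta>h
    by (rule borel_measurable_Pair[OF uh_meas \<nu>_meas[OF measurable_compose[OF snd_meas seq_past_meas]]])
  \<comment> \<open>A time shift of the process is composition with a power of \<open>T\<close>;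
    thus invariance of \<open>\<nu>\<close> becomes stationarity of all joint laws.\<close>
  have V_shift: "V (t + s) z = V t ((T ^^ s) z)" for t s z
  proof -
    have "uh (t + s) z = uh t ((T ^^ s) z)" by (simp add: uh_def funpow_add)
    moreover have "seq_past (snd z) (int (t + s)) = seq_past (snd ((T ^^ s) z)) (int t)"
      by (simp add: T_def snd_skew_map_funpow seq_past_def algebra_simps)
    ultimately show ?thesis by (simp only: V_def past_\<eta>h)
  qed

  have "distr N (\<Pi>\<^sub>M k\<in>UNIV. borel) (\<lambda>\<omega> k. \<eta>h k \<omega>) = distr M (\<Pi>\<^sub>M k\<in>UNIV. borel) (\<lambda>\<omega> k. \<eta> k \<omega>)"
  proof -
    have "distr N borel (\<lambda>\<omega> k. \<eta>h k \<omega>) = distr M borel (\<lambda>\<omega> k. \<eta> k \<omega>)"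
      using snd_\<nu> N_distr[OF \<nu>_meas[OF snd_meas]] by (simp add: \<eta>h_def P_def path_def[abs_def])
    then show ?thesis by (simp only: distr_PiM_UNIV_eq_borel)
  qed
  moreover have "uh k \<omega> \<in> X \<and> past \<eta>h (int k) \<omega> \<in> \<E>" if "\<omega> \<in> space N" for \<omega> k
  proof -
    have "\<omega> \<in> Z" using that N_space by simp
    moreover have "(T ^^ k) \<omega> \<in> Z" by (rule invariant_set_funpow[OF T_Z \<open>\<omega> \<in> Z\<close>])
    ultimately show ?thesis by (auto simp: Z_def W_def uh_def past_\<eta>h)
  qed
  moreover have "uh k \<omega> = S (uh (k - 1) \<omega>, \<eta>h (int k) \<omega>)" if "k \<ge> 1" for k \<omega>
    using fst_skew_map_funpow_Suc[of "k - 1" S \<omega>] that by (simp add: uh_def \<eta>h_def T_def)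
  moreover have "stationary_process N V"
    unfolding stationary_process_def
  proof (intro conjI allI)
    show "V t \<in> borel_measurable N" for t by (rule N_meas[OF V_meas])
    fix s
    have V_path: "(\<lambda>z t. V t z) \<in> \<nu> \<rightarrow>\<^sub>M (\<Pi>\<^sub>M t\<in>UNIV. borel)"
      by (rule measurable_PiM_UNIV_borel[OF V_meas])
    have T_pow: "T ^^ s \<in> \<nu> \<rightarrow>\<^sub>M \<nu>"
      using T_pow_meas[of s] by (simp only: measurable_cong_sets[OF refl \<nu>_sets])
    have V_shift_path: "(\<lambda>z t. V (t + s) z) \<in> \<nu> \<rightarrow>\<^sub>M (\<Pi>\<^sub>M t\<in>UNIV. borel)"
      by (rule measurable_PiM_UNIV_borel[OF V_meas])
    have "distr N (\<Pi>\<^sub>M t\<in>UNIV. borel) (\<lambda>z t. V (t + s) z)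
        = distr \<nu> (\<Pi>\<^sub>M t\<in>UNIV. borel) (\<lambda>z t. V (t + s) z)"
      by (rule N_distr[OF V_shift_path])
    also have "\<dots> = distr (distr \<nu> \<nu> (T ^^ s)) (\<Pi>\<^sub>M t\<in>UNIV. borel) (\<lambda>z t. V t z)"
      by (subst distr_distr[OF V_path T_pow]) (simp add: o_def V_shift)
    \<comment> \<open>The target of \<open>distr\<close> enters only through its space and
      sigma-algebra, so \<open>\<nu>\<close> can take the place of \<open>borel\<close> in
      \<open>inv_pow\<close>.\<close>
    also have "distr \<nu> \<nu> (T ^^ s) = \<nu>"
      using inv_pow[of s] distr_cong[of \<nu> \<nu> \<nu> borel "T ^^ s" "T ^^ s"] by simp
    also have "distr \<nu> (\<Pi>\<^sub>M t\<in>UNIV. borel) (\<lambda>z t. V t z) = distr N (\<Pi>\<^sub>M t\<in>UNIV. borel) (\<lambda>z t. V t z)"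
      by (rule N_distr[OF V_path, symmetric])
    finally show "distr N (\<Pi>\<^sub>M t\<in>UNIV. borel) (\<lambda>z t. V (t + s) z)
        = distr N (\<Pi>\<^sub>M t\<in>UNIV. borel) (\<lambda>z t. V t z)" .
  qed
  moreover have "distr N borel (uh k) = \<mu>" for k
  proof -
    have "distr N borel (uh k) = distr (distr \<nu> borel (T ^^ k)) borel fst"
      by (subst distr_distr[OF fst_meas T_pow_meas])
        (use N_distr[OF uh_meas, of k] in \<open>simp add: uh_def[abs_def] o_def\<close>)
    then show ?thesis by (simp add: inv_pow fst_\<nu>)
  qed
  moreover have "prob_space N"
  proof
    show "emeasure N (space N) = 1"
      unfolding N_space using \<nu> by (simp add: N_def emeasure_restrict_space prob_on_def)
  qed
  ultimately show ?thesis
    unfolding V_def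
    using N_meas[OF \<eta>h_meas] N_meas[OF uh_meas]
    by (intro exI[of _ N] exI[of _ \<eta>h] exI[of _ uh] conjI allI ballI impI) blast+
qed

end
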